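(* Let $Z=(z_i)_{i=1}^\ell$ be an $\ell$-point independent sample from $\mu$ and let $1\le s\le\ell$. Then, for any integer $m\ge1$, $$\mathbb{E}\left[\int_{\mathcal{X}}\sqrt{k(x,x)-k_s^Z(x,x)}\,d\mu(x)\right]\le 2\sqrt{\sum_{i>s}\sigma_i}+4\sqrt{\sum_{i>m}\sigma_i}+\frac{\sqrt{k_{\max}}}{\ell}\left(\frac{80m^2\log(1+2\ell)}{9}+69\right),$$ where the expectation is over the draws of $Z$.
   Context: $\mathcal{X}$ is a Hausdorff space, $\mu$ a (Borel) probability measure on $\mathcal{X}$, and $k:\mathcal{X}\times\mathcal{X}\to\mathbb{R}$ a bounded positive definite kernel (all Gram matrices are positive semi-definite) with reproducing kernel Hilbert space $\mathcal{H}_k$; $k_{\max}:=\sup_{x\in\mathcal{X}}k(x,x)<\infty$. The integral operator is $\mathcal{K}:L^2(\mu)\to L^2(\mu)$, $(\mathcal{K}f)(x)=\int_{\mathcal{X}}k(x,y)f(y)\,d\mu(y)$, with eigenpairs $(\sigma_i,e_i)_{i=1}^\infty$, $\sigma_1\ge\sigma_2\ge\cdots\ge0$, $(e_i)$ orthonormal in $L^2(\mu)$. Standing assumption: the Mercer decomposition $k(x,y)=\sum_{i=1}^\infty\sigma_i e_i(x)e_i(y)$ holds and $(\sqrt{\sigma_i}e_i)_{i}$ (over indices with $\sigma_i>0$) is an orthonormal basis of $\mathcal{H}_k$. Nyström approximation: for $Z=(z_i)_{i=1}^\ell$ put $k(Z,Z)=(k(z_i,z_j))_{i,j=1}^\ell$,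 $k(Z,x)=(k(z_i,x))_{i=1}^\ell\in\mathbb{R}^\ell$, $k(x,Z)=k(Z,x)^\top$. Fix $k(Z,Z)=U\,\mathrm{diag}(\lambda_1,\dots,\lambda_\ell)U^\top$ with $U=[u_1,\dots,u_\ell]$ orthogonal and $\lambda_1\ge\cdots\ge\lambda_\ell\ge0$. Then $$k_s^Z(x,y)=k(x,Z)k(Z,Z)_s^+k(Z,y)=\sum_{1\le i\le s,\ \lambda_i>0}\frac1{\lambda_i}(u_i^\top k(Z,x))(u_i^\top k(Z,y)),$$ where $k(Z,Z)_s^+$ is the Moore–Penrose pseudo-inverse of the best rank-$s$ approximation $\sum_{i\le s}\lambda_iu_iu_i^\top$ of $k(Z,Z)$. *)

theory Defs
  imports "HOL-Probability.Probability" "Jordan_Normal_Form.Matrix"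
begin

text \<open>All sequences and matrices are indexed from \<open>0\<close>: the largest eigenvalue, usually called
  \<open>\<sigma>\<^sub>1\<close>, is \<open>\<sigma> 0\<close> here, and a tail sum over the indices \<open>i > s\<close> is \<open>\<Sum>i. \<sigma> (i + s)\<close>.\<close>

no_notation inner (infix "\<bullet>" 70)
no_notation vec_nth (infixl "$" 90)

definition pos_def_kernel :: "('a \<Rightarrow> 'a \<Rightarrow> real) \<Rightarrow> bool" where
  "pos_def_kernel k \<longleftrightarrow>
     (\<forall>x y. k x y = k y x) \<and>
     (\<forall>(n::nat) (z :: nat \<Rightarrow> 'a) (c :: nat \<Rightarrow> real).
        0 \<le> (\<Sum>i<n. \<Sum>j<n. c i * c j * k (z i) (z j)))"

text \<open>\<open>H\<close> is a Hilbert space of functions, with inner product \<open>ip\<close> (only its values on \<open>H\<close>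
  matter), in which \<open>k\<close> is a reproducing kernel. By the Moore--Aronszajn theorem \<open>H\<close> and
  \<open>ip\<close> on \<open>H\<close> exist and are unique for every positive definite kernel \<open>k\<close>.\<close>

locale rkhs =
  fixes k :: "'a \<Rightarrow> 'a \<Rightarrow> real"
    and H :: "('a \<Rightarrow> real) set"
    and ip :: "('a \<Rightarrow> real) \<Rightarrow> ('a \<Rightarrow> real) \<Rightarrow> real"
  assumes zero_mem: "(\<lambda>x. 0) \<in> H"
    and add_mem: "\<And>f g. f \<in> H \<Longrightarrow> g \<in> H \<Longrightarrow> (\<lambda>x. f x + g x) \<in> H"
    and scale_mem: "\<And>c f. f \<in> H \<Longrightarrow> (\<lambda>x. c * f x) \<in> H"
    and ip_commute: "\<And>f g. f \<in> H \<Longrightarrow> g \<in> H \<Longrightarrow> ip f g = ip g f"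
    and ip_add: "\<And>f g h. f \<in> H \<Longrightarrow> g \<in> H \<Longrightarrow> h \<in> H \<Longrightarrow>
                   ip (\<lambda>x. f x + g x) h = ip f h + ip g h"
    and ip_scale: "\<And>c f g. f \<in> H \<Longrightarrow> g \<in> H \<Longrightarrow> ip (\<lambda>x. c * f x) g = c * ip f g"
    and ip_nonneg: "\<And>f. f \<in> H \<Longrightarrow> 0 \<le> ip f f"
    and ip_eq_zero: "\<And>f. f \<in> H \<Longrightarrow> ip f f = 0 \<Longrightarrow> f = (\<lambda>x. 0)"
    and complete: "\<And>F :: nat \<Rightarrow> 'a \<Rightarrow> real. (\<And>n. F n \<in> H) \<Longrightarrow>
          (\<And>\<epsilon>. \<epsilon> > 0 \<Longrightarrow> \<exists>N. \<forall>m\<ge>N. \<forall>n\<ge>N.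
             sqrt (ip (\<lambda>x. F m x - F n x) (\<lambda>x. F m x - F n x)) < \<epsilon>) \<Longrightarrow>
          \<exists>f\<in>H. (\<lambda>n. sqrt (ip (\<lambda>x. F n x - f x) (\<lambda>x. F n x - f x))) \<longlonglongrightarrow> 0"
    and kernel_mem: "\<And>x. k x \<in> H"
    and reproducing: "\<And>f x. f \<in> H \<Longrightarrow> ip f (k x) = f x"

definition orthonormal_basis ::
  "('a \<Rightarrow> real) set \<Rightarrow> (('a \<Rightarrow> real) \<Rightarrow> ('a \<Rightarrow> real) \<Rightarrow> real) \<Rightarrow> 'i set \<Rightarrow> ('i \<Rightarrow> 'a \<Rightarrow> real) \<Rightarrow> bool" where
  "orthonormal_basis H ip I b \<longleftrightarrow>
     (\<forall>i\<in>I. b i \<in> H) \<and>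
     (\<forall>i\<in>I. \<forall>j\<in>I. ip (b i) (b j) = (if i = j then 1 else 0)) \<and>
     (\<forall>f\<in>H. \<forall>\<epsilon>>0. \<exists>J c. finite J \<and> J \<subseteq> I \<and>
        sqrt (ip (\<lambda>x. f x - (\<Sum>i\<in>J. c i * b i x)) (\<lambda>x. f x - (\<Sum>i\<in>J. c i * b i x))) < \<epsilon>)"

text \<open>Square-integrable functions, not identified up to null sets: the Mercer decomposition
  evaluates the eigenfunctions at points.\<close>

definition L2 :: "'a measure \<Rightarrow> ('a \<Rightarrow> real) set" where
  "L2 M = {f \<in> borel_measurable M. integrable M (\<lambda>x. (f x)\<^sup>2)}"

definition L2_inner :: "'a measure \<Rightarrow> ('a \<Rightarrow> real) \<Rightarrow> ('a \<Rightarrow> real) \<Rightarrow> real" where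
  "L2_inner M f g = (\<integral>x. f x * g x \<partial>M)"

definition integral_operator :: "'a measure \<Rightarrow> ('a \<Rightarrow> 'a \<Rightarrow> real) \<Rightarrow> ('a \<Rightarrow> real) \<Rightarrow> 'a \<Rightarrow> real" where
  "integral_operator M k f x = (\<integral>y. k x y * f y \<partial>M)"

definition eigenpairs ::
  "'a measure \<Rightarrow> ('a \<Rightarrow> 'a \<Rightarrow> real) \<Rightarrow> (nat \<Rightarrow> real) \<Rightarrow> (nat \<Rightarrow> 'a \<Rightarrow> real) \<Rightarrow> bool" where
  "eigenpairs M k \<sigma> e \<longleftrightarrow>
     antimono \<sigma> \<and> (\<forall>i. 0 \<le> \<sigma> i) \<and>
     (\<forall>i. e i \<in> L2 M) \<and>
     (\<forall>i j. L2_inner M (e i) (e j) = (if i = j then 1 else 0)) \<and>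
     (\<forall>i. AE x in M. integral_operator M k (e i) x = \<sigma> i * e i x)"

definition gram_mat :: "('a \<Rightarrow> 'a \<Rightarrow> real) \<Rightarrow> nat \<Rightarrow> (nat \<Rightarrow> 'a) \<Rightarrow> real mat" where
  "gram_mat k l z = Matrix.mat l l (\<lambda>(i, j). k (z i) (z j))"

definition kernel_vec :: "('a \<Rightarrow> 'a \<Rightarrow> real) \<Rightarrow> nat \<Rightarrow> (nat \<Rightarrow> 'a) \<Rightarrow> 'a \<Rightarrow> real vec" where
  "kernel_vec k l z x = Matrix.vec l (\<lambda>i. k (z i) x)"

definition spectral_decomp :: "nat \<Rightarrow> real mat \<Rightarrow> real mat \<Rightarrow> (nat \<Rightarrow> real) \<Rightarrow> bool" where
  "spectral_decomp n A U lam \<longleftrightarrow>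
     U \<in> carrier_mat n n \<and> U\<^sup>T * U = 1\<^sub>m n \<and> U * U\<^sup>T = 1\<^sub>m n \<and>
     A = U * mat_diag n lam * U\<^sup>T \<and>
     (\<forall>i j. i \<le> j \<longrightarrow> j < n \<longrightarrow> lam j \<le> lam i) \<and> (\<forall>i<n. 0 \<le> lam i)"

text \<open>The matrix \<open>\<Sum>i<s. lam i \<sqdot> u\<^sub>i u\<^sub>i\<^sup>T\<close>, where \<open>u\<^sub>i\<close> is the \<open>i\<close>-th column of \<open>U\<close>.\<close>

definition truncated_mat :: "nat \<Rightarrow> real mat \<Rightarrow> (nat \<Rightarrow> real) \<Rightarrow> nat \<Rightarrow> real mat" where
  "truncated_mat n U lam s = Matrix.mat n n (\<lambda>(a, b). \<Sum>i<s. lam i * (U $$ (a, i) * U $$ (b, i)))"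

definition is_moore_penrose :: "real mat \<Rightarrow> real mat \<Rightarrow> bool" where
  "is_moore_penrose A X \<longleftrightarrow>
     X \<in> carrier_mat (dim_col A) (dim_row A) \<and>
     A * X * A = A \<and> X * A * X = X \<and> (A * X)\<^sup>T = A * X \<and> (X * A)\<^sup>T = X * A"

definition pseudo_inverse :: "real mat \<Rightarrow> real mat" where
  "pseudo_inverse A = (THE X. is_moore_penrose A X)"

definition nystrom ::
  "('a \<Rightarrow> 'a \<Rightarrow> real) \<Rightarrow> nat \<Rightarrow> (nat \<Rightarrow> 'a) \<Rightarrow> real mat \<Rightarrow> (nat \<Rightarrow> real) \<Rightarrow> nat \<Rightarrow> 'a \<Rightarrow> 'a \<Rightarrow> real" where
  "nystrom k l z U lam s x y =
     kernel_vec k l z x \<bullet> (pseudo_inverse (truncated_mat l U lam s) *\<^sub>v kernel_vec k l z y)"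

lemma is_moore_penrose_unique:
  assumes A: "A \<in> carrier_mat n n" and X: "is_moore_penrose A X" and Y: "is_moore_penrose A Y"
  shows "X = Y"
proof -
  have cX: "X \<in> carrier_mat n n" and cY: "Y \<in> carrier_mat n n"
    using A X Y unfolding is_moore_penrose_def by (metis carrier_matD)+
  have X1: "A * X * A = A" and X2: "X * A * X = X"
    and X3: "(A * X)\<^sup>T = A * X" and X4: "(X * A)\<^sup>T = X * A"
    using X unfolding is_moore_penrose_def by blast+
  have Y1: "A * Y * A = A" and Y2: "Y * A * Y = Y"
    and Y3: "(A * Y)\<^sup>T = A * Y" and Y4: "(Y * A)\<^sup>T = Y * A"
    using Y unfolding is_moore_penrose_def by blast+
  note as = assoc_mult_mat[of _ n n _ n _ n]
  note c = A cX cY mult_carrier_mat[of _ n n _ n]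
  have "A * X = (A * Y * A * X)\<^sup>T" unfolding Y1 X3 ..
  also have "\<dots> = ((A * Y) * (A * X))\<^sup>T" by (simp add: as c)
  also have "\<dots> = (A * X)\<^sup>T * (A * Y)\<^sup>T" by (rule transpose_mult) (use c in blast)+
  also have "\<dots> = (A * X) * (A * Y)" unfolding X3 Y3 ..
  also have "\<dots> = A * X * A * Y" by (simp add: as c)
  also have "\<dots> = A * Y" unfolding X1 ..
  finally have 1: "A * X = A * Y" .
  have "X * A = (X * (A * Y * A))\<^sup>T" unfolding Y1 X4 ..
  also have "\<dots> = ((X * A) * (Y * A))\<^sup>T" by (simp add: as c)
  also have "\<dots> = (Y * A)\<^sup>T * (X * A)\<^sup>T" by (rule transpose_mult) (use c in blast)+
  also have "\<dots> = (Y * A) * (X * A)" unfolding X4 Y4 ..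
  also have "\<dots> = Y * (A * X * A)" by (simp add: as c)
  also have "\<dots> = Y * A" unfolding X1 ..
  finally have 2: "X * A = Y * A" .
  have "X = X * A * X" unfolding X2 ..
  also have "\<dots> = Y * (A * X)" unfolding 2 by (simp add: as c)
  also have "\<dots> = Y * A * Y" unfolding 1 by (simp add: as c)
  also have "\<dots> = Y" by (rule Y2)
  finally show ?thesis .
qed

lemma conj_diag_mult:
  assumes U: "U \<in> carrier_mat n n" and o: "U\<^sup>T * U = (1\<^sub>m n :: real mat)"
  shows "(U * mat_diag n f * U\<^sup>T) * (U * mat_diag n g * U\<^sup>T) = U * mat_diag n (\<lambda>i. f i * g i) * U\<^sup>T"
proof -
  define V F G where "V = U\<^sup>T" and "F = mat_diag n f" and "G = mat_diag n g"
  have c: "U \<in> carrier_mat n n" "V \<in> carrier_mat n n" "F \<in> carrier_mat n n" "G \<in> carrier_mat n n"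
    using U by (simp_all add: V_def F_def G_def)
  note as = assoc_mult_mat[of _ n n _ n _ n] mult_carrier_mat[of _ n n _ n]
  have "(U * F * V) * (U * G * V) = U * (F * ((V * U) * (G * V)))" by (simp add: as c)
  also have "V * U = 1\<^sub>m n" using o by (simp add: V_def)
  also have "1\<^sub>m n * (G * V) = G * V" by (rule left_mult_one_mat[of _ n n]) (simp add: as c)
  also have "U * (F * (G * V)) = U * (F * G) * V" by (simp add: as c)
  finally show ?thesis by (simp add: V_def F_def G_def)
qed

lemma conj_diag_sym:
  assumes U: "U \<in> carrier_mat n n"
  shows "(U * mat_diag n f * U\<^sup>T)\<^sup>T = U * mat_diag n (f :: nat \<Rightarrow> real) * U\<^sup>T"
proof -
  define F where "F = mat_diag n f"
  have d: "F\<^sup>T = F" by (rule eq_matI) (auto simp: F_def mat_diag_def)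
  have F: "F \<in> carrier_mat n n" by (simp add: F_def)
  have "(U * F * U\<^sup>T)\<^sup>T = (U\<^sup>T)\<^sup>T * (U * F)\<^sup>T"
    by (rule transpose_mult[of _ n n _ n]) (use U F in auto)
  also have "(U * F)\<^sup>T = F\<^sup>T * U\<^sup>T" by (rule transpose_mult[OF U F])
  also have "(U\<^sup>T)\<^sup>T * (F\<^sup>T * U\<^sup>T) = U * F * U\<^sup>T"
    unfolding d transpose_transpose by (rule assoc_mult_mat[OF U F, symmetric]) (use U in simp)
  finally show ?thesis by (simp add: F_def)
qed

lemma mat_diag_mult_vec_index:
  assumes "v \<in> carrier_vec n" and "i < n"
  shows "(mat_diag n g *\<^sub>v v) $ i = g i * (v $ i :: real)"
proof -
  have "(mat_diag n g *\<^sub>v v) $ i = (\<Sum>j\<in>{0..<n}. (if i = j then g j else 0) * v $ j)"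
    using assms by (auto simp: mat_diag_def scalar_prod_def intro!: sum.cong)
  also have "\<dots> = (\<Sum>j\<in>{0..<n}. if j = i then g i * v $ i else 0)"
    by (rule sum.cong) auto
  finally show ?thesis using assms by simp
qed

lemma truncated_mat_eq:
  assumes U: "U \<in> carrier_mat n n" and s: "s \<le> n"
  shows "truncated_mat n U lam s = U * mat_diag n (\<lambda>i. if i < s then lam i else 0) * U\<^sup>T"
proof (rule eq_matI)
  fix a b assume "a < dim_row (U * mat_diag n (\<lambda>i. if i < s then lam i else 0) * U\<^sup>T)"
    and "b < dim_col (U * mat_diag n (\<lambda>i. if i < s then lam i else 0) * U\<^sup>T)"
  with U have ab: "a < n" "b < n" by auto
  have "(\<Sum>i<s. lam i * (U $$ (a, i) * U $$ (b, i)))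
      = (\<Sum>i\<in>{0..<n}. U $$ (a, i) * (if i < s then lam i else 0) * U $$ (b, i))"
    by (rule sum.mono_neutral_cong_left) (use s in auto)
  then show "truncated_mat n U lam s $$ (a, b)
      = (U * mat_diag n (\<lambda>i. if i < s then lam i else 0) * U\<^sup>T) $$ (a, b)"
    unfolding mat_diag_mult_right[OF U] truncated_mat_def
    using U ab by (simp add: scalar_prod_def)
qed (use U in \<open>auto simp: truncated_mat_def\<close>)

lemma pseudo_inverse_truncated_mat:
  assumes U: "U \<in> carrier_mat n n" and o: "U\<^sup>T * U = (1\<^sub>m n :: real mat)" and s: "s \<le> n"
  shows "pseudo_inverse (truncated_mat n U lam s)
           = U * mat_diag n (\<lambda>i. if i < s then inverse (lam i) else 0) * U\<^sup>T"
proof -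
  let ?f = "\<lambda>i. if i < s then lam i else 0" and ?g = "\<lambda>i. if i < s then inverse (lam i) else 0"
  have 1: "(\<lambda>i. ?f i * ?g i * ?f i) = ?f" "(\<lambda>i. ?g i * ?f i * ?g i) = ?g"
    by (auto simp: fun_eq_iff) (metis left_inverse right_inverse)+
  have "is_moore_penrose (truncated_mat n U lam s) (U * mat_diag n ?g * U\<^sup>T)"
    unfolding truncated_mat_eq[OF U s] is_moore_penrose_def conj_diag_mult[OF U o] conj_diag_sym[OF U] 1
    using U by auto
  moreover have "truncated_mat n U lam s \<in> carrier_mat n n" by (simp add: truncated_mat_def)
  ultimately show ?thesis
    unfolding pseudo_inverse_def using is_moore_penrose_unique by (intro the_equality) auto
qed

lemma nystrom_eq_sum:
  assumes sd: "spectral_decomp l (gram_mat k l z) U lam" and s: "s \<le> l"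
  shows "nystrom k l z U lam s x y =
    (\<Sum>i | i < s \<and> lam i > 0.
       1 / lam i * (col U i \<bullet> kernel_vec k l z x) * (col U i \<bullet> kernel_vec k l z y))"
proof -
  define g where "g = (\<lambda>i. if i < s then inverse (lam i) else 0)"
  define a b where "a = kernel_vec k l z x" and "b = kernel_vec k l z y"
  have U: "U \<in> carrier_mat l l" and o: "U\<^sup>T * U = 1\<^sub>m l" and nn: "\<And>i. i < l \<Longrightarrow> 0 \<le> lam i"
    using sd by (auto simp: spectral_decomp_def)
  have a: "a \<in> carrier_vec l" and b: "b \<in> carrier_vec l" by (auto simp: kernel_vec_def a_def b_def)
  have D: "mat_diag l g \<in> carrier_mat l l" and U': "U\<^sup>T \<in> carrier_mat l l" using U by simp_all
  have Ub: "U\<^sup>T *\<^sub>v b \<in> carrier_vec l" by (rule mult_mat_vec_carrier[OF U' b])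
  have DUb: "mat_diag l g *\<^sub>v (U\<^sup>T *\<^sub>v b) \<in> carrier_vec l" by (rule mult_mat_vec_carrier[OF D Ub])
  have "nystrom k l z U lam s x y = a \<bullet> ((U * mat_diag l g * U\<^sup>T) *\<^sub>v b)"
    unfolding nystrom_def pseudo_inverse_truncated_mat[OF U o s] a_def b_def g_def ..
  also have "(U * mat_diag l g * U\<^sup>T) *\<^sub>v b = (U * mat_diag l g) *\<^sub>v (U\<^sup>T *\<^sub>v b)"
    by (rule assoc_mult_mat_vec[OF mult_carrier_mat[OF U D] U' b])
  also have "\<dots> = U *\<^sub>v (mat_diag l g *\<^sub>v (U\<^sup>T *\<^sub>v b))"
    by (rule assoc_mult_mat_vec[OF U D Ub])
  also have "a \<bullet> \<dots> = (U\<^sup>T *\<^sub>v a) \<bullet> (mat_diag l g *\<^sub>v (U\<^sup>T *\<^sub>v b))"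
    by (rule transpose_vec_mult_scalar[OF U DUb a, symmetric])
  also have "\<dots> = (\<Sum>i\<in>{0..<l}. (U\<^sup>T *\<^sub>v a) $ i * (mat_diag l g *\<^sub>v (U\<^sup>T *\<^sub>v b)) $ i)"
    unfolding scalar_prod_def[of "U\<^sup>T *\<^sub>v a"] carrier_vecD[OF DUb] ..
  also have "\<dots> = (\<Sum>i\<in>{0..<l}. g i * (col U i \<bullet> a) * (col U i \<bullet> b))"
    by (rule sum.cong) (use U in \<open>simp_all add: mat_diag_mult_vec_index[OF Ub] del: index_mult_mat_vec,
          simp add: ac_simps\<close>)
  also have "\<dots> = (\<Sum>i | i < s \<and> lam i > 0. 1 / lam i * (col U i \<bullet> a) * (col U i \<bullet> b))"
  proof (rule sum.mono_neutral_cong_right)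
    show "\<forall>i\<in>{0..<l} - {i. i < s \<and> lam i > 0}. g i * (col U i \<bullet> a) * (col U i \<bullet> b) = 0"
    proof
      fix i assume "i \<in> {0..<l} - {i. i < s \<and> lam i > 0}"
      then have "\<not> i < s \<or> lam i = 0" using nn[of i] by auto
      then show "g i * (col U i \<bullet> a) * (col U i \<bullet> b) = 0" by (auto simp: g_def)
    qed
    show "g i * (col U i \<bullet> a) * (col U i \<bullet> b) = 1 / lam i * (col U i \<bullet> a) * (col U i \<bullet> b)"
      if "i \<in> {i. i < s \<and> lam i > 0}" for i
      using that by (simp add: g_def inverse_eq_divide)
  qed (use s in auto)
  finally show ?thesis unfolding a_def b_def .
qed

end

theory Submission
  imports Defs
begin

text \<open>The residual is \<open>k x x - k\<^sub>s x x = (norm (Q k\<^sub>x))\<^sup>2\<close> for the orthogonal projection \<open>Q\<close> in the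
  RKHS onto the complement of the span of the top \<open>s\<close> eigenvectors of the empirical covariance
  operator. Up to the error \<open>sqrt (\<Sum>i\<ge>m. \<phi> i x ^ 2)\<close>, where \<open>\<phi> i = sqrt (\<sigma> i) * e i\<close>, its square
  root \<open>g\<close> equals \<open>sqrt (\<Sum>i,j<m. \<phi> i x * \<phi> j x * A i j)\<close> with a matrix \<open>A\<close> that depends on the sample
  and has entries in \<open>[-1, 1]\<close>.

  Rounding the entries of \<open>A\<close> to multiples of \<open>1 / l ^ 3\<close> leaves at most \<open>(1 + 2 * l ^ 3) ^ (m * m)\<close>
  functions, at the price of an error \<open>b / l\<close>, where \<open>b = sqrt k\<^sub>m\<^sub>a\<^sub>x\<close>. For each single function
  \<open>f\<close> with values in \<open>[0, b]\<close>, the quantity \<open>\<mu> f - 2 \<mu>\<^sub>l f\<close> (\<open>\<mu>\<^sub>l\<close> is the empirical mean) has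
  exponential moment at most \<open>1\<close> at the scale \<open>b / l\<close>, so its maximum over \<open>N\<close> functions has expectation
  at most \<open>2 * b * ln N / l\<close>. Finally \<open>\<mu>\<^sub>l g\<close> is bounded through Jensen's inequality and Ky Fan's
  maximum principle: the top \<open>s\<close> empirical eigenvectors minimise the total squared residual on the
  sample, so they do at least as well as the span of \<open>\<phi> 0, ..., \<phi> (s - 1)\<close>. If \<open>l < m\<close>, the
  claimed bound exceeds \<open>b\<close> and is trivial.\<close>

section \<open>Residuals of orthogonal projections\<close>

text \<open>The form may be degenerate, so that the locale also covers \<open>residual\<close>
  below, which can vanish in the directions projected out.\<close>

locale semi_inner =
  fixes H :: "('a \<Rightarrow> real) set"
    and q :: "('a \<Rightarrow> real) \<Rightarrow> ('a \<Rightarrow> real) \<Rightarrow> real"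
  assumes zero_mem: "(\<lambda>x. 0) \<in> H"
    and add_mem: "\<And>f g. f \<in> H \<Longrightarrow> g \<in> H \<Longrightarrow> (\<lambda>x. f x + g x) \<in> H"
    and scale_mem: "\<And>c f. f \<in> H \<Longrightarrow> (\<lambda>x. c * f x) \<in> H"
    and commute: "\<And>f g. f \<in> H \<Longrightarrow> g \<in> H \<Longrightarrow> q f g = q g f"
    and add_left: "\<And>f g h. f \<in> H \<Longrightarrow> g \<in> H \<Longrightarrow> h \<in> H \<Longrightarrow> q (\<lambda>x. f x + g x) h = q f h + q g h"
    and scale_left: "\<And>c f g. f \<in> H \<Longrightarrow> g \<in> H \<Longrightarrow> q (\<lambda>x. c * f x) g = c * q f g"
    and nonneg: "\<And>f. f \<in> H \<Longrightarrow> 0 \<le> q f f"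
begin

lemma add_right:
  "f \<in> H \<Longrightarrow> g \<in> H \<Longrightarrow> h \<in> H \<Longrightarrow> q h (\<lambda>x. f x + g x) = q h f + q h g"
  using commute[of h "\<lambda>x. f x + g x"] commute[of h f] commute[of h g] add_left[of f g h] add_mem[of f g]
  by simp

lemma scale_right: "f \<in> H \<Longrightarrow> g \<in> H \<Longrightarrow> q g (\<lambda>x. c * f x) = c * q g f"
  using commute[of g "\<lambda>x. c * f x"] commute[of g f] scale_left[of f g c] scale_mem[of f c]
  by simp

lemma sum_mem:
  assumes "\<And>j. j \<in> J \<Longrightarrow> f j \<in> H"
  shows "(\<lambda>x. \<Sum>j\<in>J. c j * f j x) \<in> H"
  using assms
proof (induction J rule: infinite_finite_induct)
  case (insert i J)
  then have "(\<lambda>x. c i * f i x + (\<Sum>j\<in>J. c j * f j x)) \<in> H"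
    by (intro add_mem scale_mem) simp_all
  with insert.hyps show ?case by simp
qed (simp_all add: zero_mem)

lemma sum_left:
  assumes "\<And>j. j \<in> J \<Longrightarrow> f j \<in> H" and g: "g \<in> H"
  shows "q (\<lambda>x. \<Sum>j\<in>J. c j * f j x) g = (\<Sum>j\<in>J. c j * q (f j) g)"
proof -
  have 0: "q (\<lambda>x. 0) g = 0"
    using scale_left[OF zero_mem g, of 0] by simp
  show ?thesis
    using assms(1)
  proof (induction J rule: infinite_finite_induct)
    case (insert i J)
    then show ?case
      using add_left[OF scale_mem[of "f i" "c i"] sum_mem[of J f c] g]
      by (simp add: scale_left g)
  qed (simp_all add: 0)
qed

lemma sum_right:
  assumes "\<And>j. j \<in> J \<Longrightarrow> f j \<in> H" and g: "g \<in> H"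
  shows "q g (\<lambda>x. \<Sum>j\<in>J. c j * f j x) = (\<Sum>j\<in>J. c j * q g (f j))"
proof -
  have "q g (\<lambda>x. \<Sum>j\<in>J. c j * f j x) = q (\<lambda>x. \<Sum>j\<in>J. c j * f j x) g"
    using assms by (intro commute sum_mem)
  also have "\<dots> = (\<Sum>j\<in>J. c j * q (f j) g)"
    using assms by (rule sum_left)
  also have "\<dots> = (\<Sum>j\<in>J. c j * q g (f j))"
    using assms by (intro sum.cong) (auto simp: commute[of _ g])
  finally show ?thesis .
qed

lemma expand_add:
  assumes "f \<in> H" "g \<in> H"
  shows "q (\<lambda>x. f x + c * g x) (\<lambda>x. f x + c * g x) = q f f + 2 * c * q f g + c\<^sup>2 * q g g"
proof -
  note cg = scale_mem[OF assms(2), of c]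
  note fcg = add_mem[OF assms(1) cg]
  have "q (\<lambda>x. f x + c * g x) (\<lambda>x. f x + c * g x) = q f f + c * q f g + c * (q g f + c * q g g)"
    unfolding add_left[OF assms(1) cg fcg] scale_left[OF assms(2) fcg]
      add_right[OF assms(1) cg assms(1)] add_right[OF assms(1) cg assms(2)]
      scale_right[OF assms(2,1)] scale_right[OF assms(2,2)] ..
  also have "q g f = q f g" by (rule commute[OF assms(2,1)])
  finally show ?thesis by (simp add: power2_eq_square distrib_left)
qed

lemma cauchy_schwarz:
  assumes "f \<in> H" "g \<in> H"
  shows "(q f g)\<^sup>2 \<le> q f f * q g g"
proof -
  have *: "0 \<le> q f f + 2 * c * q f g + c\<^sup>2 * q g g" for c
    using nonneg[OF add_mem[OF assms(1) scale_mem[OF assms(2), of c]]]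
    unfolding expand_add[OF assms] .
  show ?thesis
  proof (cases "q g g = 0")
    case True
    have "q f g = 0"
    proof (rule ccontr)
      assume "q f g \<noteq> 0"
      \<comment> \<open>With \<open>q g g = 0\<close> the quadratic is affine in \<open>c\<close>;
        this \<open>c\<close> gives it the value \<open>- 1\<close>.\<close>
      then have "2 * (- (q f f + 1) / (2 * q f g)) * q f g = - (q f f + 1)" by simp
      then show False
        using *[of "- (q f f + 1) / (2 * q f g)"] True nonneg[OF assms(1)] by simp
    qed
    then show ?thesis using True by simp
  next
    case False
    then have "q g g > 0" using nonneg[OF assms(2)] by simp
    then have "q f f + 2 * (- q f g / q g g) * q f g + (- q f g / q g g)\<^sup>2 * q g g
        = (q f f * q g g - (q f g)\<^sup>2) / q g g"
      by (simp add: field_simps power2_eq_square)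
    then show ?thesis
      using *[of "- q f g / q g g"] \<open>q g g > 0\<close> by (simp add: zero_le_divide_iff)
  qed
qed

lemma triangle:
  assumes "f \<in> H" "g \<in> H"
  shows "sqrt (q (\<lambda>x. f x + g x) (\<lambda>x. f x + g x)) \<le> sqrt (q f f) + sqrt (q g g)"
proof -
  have "q f g \<le> sqrt (q f f) * sqrt (q g g)"
    using real_le_rsqrt[OF cauchy_schwarz[OF assms]] by (simp add: real_sqrt_mult)
  then have "q (\<lambda>x. f x + g x) (\<lambda>x. f x + g x) \<le> (sqrt (q f f) + sqrt (q g g))\<^sup>2"
    using expand_add[OF assms, of 1] nonneg[OF assms(1)] nonneg[OF assms(2)]
    by (simp add: power2_sum)
  then show ?thesis
    by (rule real_le_lsqrt[rotated]) (simp add: nonneg[OF assms(1)] nonneg[OF assms(2)])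
qed

lemma abs_le_one:
  assumes "f \<in> H" "g \<in> H" "q f f \<le> 1" "q g g \<le> 1"
  shows "\<bar>q f g\<bar> \<le> 1"
proof -
  have "q f f * q g g \<le> 1 * 1"
    using assms(3,4) nonneg[OF assms(1)] nonneg[OF assms(2)] by (intro mult_mono) simp_all
  then have "(q f g)\<^sup>2 \<le> 1"
    using cauchy_schwarz[OF assms(1,2)] by linarith
  then show ?thesis by (simp add: abs_square_le_1)
qed

end

text \<open>Norms at most \<open>1\<close> instead of equal to \<open>1\<close> admit zero vectors,
  so vanishing eigenvalues need no separate index set.\<close>

locale sub_orthonormal = semi_inner H q
  for H :: "('a \<Rightarrow> real) set" and q +
  fixes J :: "'i set" and v :: "'i \<Rightarrow> 'a \<Rightarrow> real"
  assumes finite_index: "finite J"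
    and mem: "\<And>j. j \<in> J \<Longrightarrow> v j \<in> H"
    and orth: "\<And>i j. i \<in> J \<Longrightarrow> j \<in> J \<Longrightarrow> i \<noteq> j \<Longrightarrow> q (v i) (v j) = 0"
    and norm_le: "\<And>j. j \<in> J \<Longrightarrow> q (v j) (v j) \<le> 1"
begin

lemma norm_sum_le:
  "q (\<lambda>x. \<Sum>j\<in>J. c j * v j x) (\<lambda>x. \<Sum>j\<in>J. c j * v j x) \<le> (\<Sum>j\<in>J. (c j)\<^sup>2)"
proof -
  have "q (\<lambda>x. \<Sum>j\<in>J. c j * v j x) (\<lambda>x. \<Sum>j\<in>J. c j * v j x)
      = (\<Sum>i\<in>J. c i * q (v i) (\<lambda>x. \<Sum>j\<in>J. c j * v j x))"
    by (intro sum_left sum_mem mem)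
  also have "\<dots> = (\<Sum>i\<in>J. c i * (\<Sum>j\<in>J. c j * q (v i) (v j)))"
    by (intro sum.cong refl arg_cong2[of _ _ _ _ "(*)"] sum_right mem)
  also have "\<dots> = (\<Sum>i\<in>J. c i * (\<Sum>j\<in>J. if i = j then c i * q (v i) (v i) else 0))"
    by (intro sum.cong arg_cong2[of _ _ _ _ "(*)"] refl) (auto simp: orth)
  also have "\<dots> = (\<Sum>i\<in>J. (c i)\<^sup>2 * q (v i) (v i))"
    by (intro sum.cong) (auto simp: finite_index power2_eq_square)
  also have "\<dots> \<le> (\<Sum>i\<in>J. (c i)\<^sup>2)"
    by (intro sum_mono) (simp add: mult_left_le norm_le)
  finally show ?thesis .
qed

text \<open>The sum of squares equals \<open>q f p\<close> and bounds \<open>q p p\<close> from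
  above. Only an inequality results, since \<open>p\<close> need not be the projection when some
  \<open>v j\<close> is shorter than \<open>1\<close>.\<close>

lemma norm_diff_le:
  assumes f: "f \<in> H"
  defines "p \<equiv> \<lambda>x. \<Sum>j\<in>J. q f (v j) * v j x"
  shows "q (\<lambda>x. f x + (- 1) * p x) (\<lambda>x. f x + (- 1) * p x) \<le> q f f - (\<Sum>j\<in>J. (q f (v j))\<^sup>2)"
proof -
  have p: "p \<in> H" unfolding p_def by (rule sum_mem[OF mem])
  have "q f p = (\<Sum>j\<in>J. (q f (v j))\<^sup>2)"
    unfolding p_def by (subst sum_right[OF mem f]) (simp_all add: power2_eq_square)
  moreover have "q p p \<le> (\<Sum>j\<in>J. (q f (v j))\<^sup>2)"
    unfolding p_def by (rule norm_sum_le)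
  ultimately show ?thesis
    using expand_add[OF f p, of "- 1"] by simp
qed

lemma bessel:
  assumes f: "f \<in> H"
  shows "(\<Sum>j\<in>J. (q f (v j))\<^sup>2) \<le> q f f"
proof -
  have "(\<lambda>x. f x + (- 1) * (\<Sum>j\<in>J. q f (v j) * v j x)) \<in> H"
    by (rule add_mem[OF f scale_mem[OF sum_mem[OF mem]]])
  from nonneg[OF this] norm_diff_le[OF f] show ?thesis by linarith
qed

text \<open>When each \<open>v j\<close> has norm \<open>0\<close> or \<open>1\<close>, this is
  \<open>q (Q f) (Q g)\<close> for the orthogonal projection \<open>Q\<close> onto the complement of
  their span, written without \<open>Q\<close>.\<close>

definition residual :: "('a \<Rightarrow> real) \<Rightarrow> ('a \<Rightarrow> real) \<Rightarrow> real" where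
  "residual f g = q f g - (\<Sum>j\<in>J. q f (v j) * q g (v j))"

lemma residual_le: "residual f f \<le> q f f"
  unfolding residual_def using sum_nonneg[of J "\<lambda>j. q f (v j) * q f (v j)"] by simp

text \<open>Positivity is Bessel's inequality. It makes Cauchy-Schwarz and the triangle inequality
  available for \<open>residual\<close>.\<close>

lemma semi_inner_residual: "semi_inner H residual"
proof
  show "residual f g = residual g f" if "f \<in> H" "g \<in> H" for f g
    by (simp add: residual_def commute[OF that] mult.commute)
  show "residual (\<lambda>x. f x + g x) h = residual f h + residual g h" if "f \<in> H" "g \<in> H" "h \<in> H" for f g h
  proof -
    have "(\<Sum>j\<in>J. q (\<lambda>x. f x + g x) (v j) * q h (v j))
        = (\<Sum>j\<in>J. q f (v j) * q h (v j) + q g (v j) * q h (v j))"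
      by (intro sum.cong refl) (simp only: add_left[OF that(1,2) mem] distrib_right)
    then show ?thesis
      unfolding residual_def add_left[OF that] sum.distrib by linarith
  qed
  show "residual (\<lambda>x. c * f x) g = c * residual f g" if "f \<in> H" "g \<in> H" for c f g
  proof -
    have "(\<Sum>j\<in>J. q (\<lambda>x. c * f x) (v j) * q g (v j)) = (\<Sum>j\<in>J. c * (q f (v j) * q g (v j)))"
      by (intro sum.cong refl) (simp only: scale_left[OF that(1) mem] mult.assoc)
    then show ?thesis
      unfolding residual_def scale_left[OF that] sum_distrib_left[symmetric] right_diff_distrib by simp
  qed
  show "0 \<le> residual f f" if "f \<in> H" for f
    using bessel[OF that] by (simp add: residual_def power2_eq_square)
qed (fact zero_mem add_mem scale_mem)+

end

section \<open>The Nystroem residual at a fixed sample\<close>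

lemma rkhs_semi_inner:
  assumes "rkhs k H ip"
  shows "semi_inner H ip"
proof -
  interpret rkhs k H ip by fact
  show ?thesis
    by standard (fact zero_mem add_mem scale_mem ip_commute ip_add ip_scale ip_nonneg)+
qed

lemma spectral_decomp_gram_mat:
  assumes "spectral_decomp l (gram_mat k l Z) U lam"
  shows "i < l \<Longrightarrow> j < l \<Longrightarrow> (\<Sum>a<l. U $$ (a, i) * U $$ (a, j)) = (if i = j then 1 else 0)"
    and "i < l \<Longrightarrow> j < l \<Longrightarrow> (\<Sum>a<l. U $$ (i, a) * U $$ (j, a)) = (if i = j then 1 else 0)"
    and "i < l \<Longrightarrow> j < l \<Longrightarrow> k (Z i) (Z j) = (\<Sum>a<l. lam a * U $$ (i, a) * U $$ (j, a))"
proof -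
  have U: "U \<in> carrier_mat l l" and 1: "U\<^sup>T * U = 1\<^sub>m l" and 2: "U * U\<^sup>T = 1\<^sub>m l"
    and 3: "gram_mat k l Z = U * mat_diag l lam * U\<^sup>T"
    using assms by (auto simp: spectral_decomp_def)
  show "(\<Sum>a<l. U $$ (a, i) * U $$ (a, j)) = (if i = j then 1 else 0)" if "i < l" "j < l"
    using arg_cong[OF 1, of "\<lambda>A. A $$ (i, j)"] U that
    by (simp add: scalar_prod_def lessThan_atLeast0)
  show "(\<Sum>a<l. U $$ (i, a) * U $$ (j, a)) = (if i = j then 1 else 0)" if "i < l" "j < l"
    using arg_cong[OF 2, of "\<lambda>A. A $$ (i, j)"] U that
    by (simp add: scalar_prod_def lessThan_atLeast0)
  show "k (Z i) (Z j) = (\<Sum>a<l. lam a * U $$ (i, a) * U $$ (j, a))" if "i < l" "j < l"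
    using arg_cong[OF 3, of "\<lambda>A. A $$ (i, j)"] U that
    unfolding mat_diag_mult_right[OF U]
    by (simp add: scalar_prod_def gram_mat_def lessThan_atLeast0 mult.commute[of "lam _"])
qed

text \<open>The family \<open>\<phi>\<close> stands for the scaled eigenfunctions \<open>sqrt (\<sigma> i) * e i\<close>; those with
  \<open>\<sigma> i = 0\<close> vanish, so \<open>\<phi>\<close> is orthogonal with norms at most \<open>1\<close> but not orthonormal.\<close>

locale nystrom_features = rkhs k H ip
  for k :: "'a \<Rightarrow> 'a \<Rightarrow> real" and H ip +
  fixes \<phi> :: "nat \<Rightarrow> 'a \<Rightarrow> real" and l s :: nat and Z :: "nat \<Rightarrow> 'a"
    and U :: "real mat" and lam :: "nat \<Rightarrow> real"
  assumes feature_mem: "\<And>i. \<phi> i \<in> H"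
    and feature_orth: "\<And>i j. i \<noteq> j \<Longrightarrow> ip (\<phi> i) (\<phi> j) = 0"
    and feature_norm_le: "\<And>i. ip (\<phi> i) (\<phi> i) \<le> 1"
    and spectral: "spectral_decomp l (gram_mat k l Z) U lam"
    and rank_pos: "1 \<le> s" and rank_le: "s \<le> l"
begin

sublocale semi_inner H ip
  by (rule rkhs_semi_inner) (fact rkhs_axioms)

sublocale \<phi>: sub_orthonormal H ip "{..<n}" \<phi> for n
  by standard (auto simp: feature_mem feature_orth feature_norm_le)

lemma lam_nonneg: "j < l \<Longrightarrow> 0 \<le> lam j"
  and lam_antimono: "i \<le> j \<Longrightarrow> j < l \<Longrightarrow> lam j \<le> lam i"
  using spectral by (auto simp: spectral_decomp_def)

lemma reproducing': "f \<in> H \<Longrightarrow> ip (k x) f = f x"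
  by (metis reproducing kernel_mem ip_commute)

text \<open>The eigenvectors of the empirical covariance operator \<open>\<Sum>a<l. k\<^sub>a \<otimes> k\<^sub>a\<close>, where
  \<open>k\<^sub>a = k (Z a)\<close>; they are zero when \<open>lam j = 0\<close> because \<open>1 / sqrt 0 = 0\<close>.\<close>

definition emp_eigenvec :: "nat \<Rightarrow> 'a \<Rightarrow> real" where
  "emp_eigenvec j x = (\<Sum>a<l. (U $$ (a, j) / sqrt (lam j)) * k (Z a) x)"

lemma emp_eigenvec_mem: "emp_eigenvec j \<in> H"
  unfolding emp_eigenvec_def by (rule sum_mem) (rule kernel_mem)

lemma gram_eigenvec:
  assumes "j < l" "b < l"
  shows "(\<Sum>a<l. U $$ (a, j) * k (Z a) (Z b)) = lam j * U $$ (b, j)"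
proof -
  have "(\<Sum>a<l. U $$ (a, j) * k (Z a) (Z b))
      = (\<Sum>a<l. \<Sum>i<l. lam i * U $$ (b, i) * (U $$ (a, j) * U $$ (a, i)))"
    using assms by (simp add: spectral_decomp_gram_mat(3)[OF spectral] sum_distrib_left ac_simps)
  also have "\<dots> = (\<Sum>i<l. lam i * U $$ (b, i) * (\<Sum>a<l. U $$ (a, j) * U $$ (a, i)))"
    by (subst sum.swap) (simp add: sum_distrib_left)
  also have "\<dots> = (\<Sum>i<l. if j = i then lam i * U $$ (b, i) else 0)"
    using assms by (intro sum.cong) (auto simp: spectral_decomp_gram_mat(1)[OF spectral])
  finally show ?thesis
    using assms by simp
qed

lemma emp_eigenvec_sample:
  assumes "j < l" "b < l"
  shows "emp_eigenvec j (Z b) = sqrt (lam j) * U $$ (b, j)"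
proof -
  have "emp_eigenvec j (Z b) = lam j * U $$ (b, j) / sqrt (lam j)"
    unfolding emp_eigenvec_def times_divide_eq_left sum_divide_distrib[symmetric] gram_eigenvec[OF assms] ..
  \<comment> \<open>This includes \<open>lam j = 0\<close>, where
    \<open>0 / sqrt 0 = 0\<close>.\<close>
  also have "\<dots> = sqrt (lam j) * U $$ (b, j)"
    using real_div_sqrt[OF lam_nonneg[OF assms(1)]] by (metis times_divide_eq_left)
  finally show ?thesis .
qed

lemma ip_emp_eigenvec:
  assumes "f \<in> H"
  shows "ip f (emp_eigenvec j) = (\<Sum>a<l. U $$ (a, j) * f (Z a)) / sqrt (lam j)"
  unfolding emp_eigenvec_def
  by (subst sum_right[OF kernel_mem assms]) (simp add: reproducing[OF assms] sum_divide_distrib)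

lemma ip_emp_eigenvec_emp_eigenvec:
  assumes "i < l" "j < l"
  shows "ip (emp_eigenvec i) (emp_eigenvec j) = (if i = j \<and> lam i \<noteq> 0 then 1 else 0)"
proof -
  have "ip (emp_eigenvec i) (emp_eigenvec j)
      = sqrt (lam i) * (\<Sum>a<l. U $$ (a, j) * U $$ (a, i)) / sqrt (lam j)"
    by (simp add: ip_emp_eigenvec[OF emp_eigenvec_mem] emp_eigenvec_sample[OF assms(1)]
        sum_distrib_left mult.left_commute)
  then show ?thesis
    using assms by (simp add: spectral_decomp_gram_mat(1)[OF spectral])
qed

lemma sub_orthonormal_emp_eigenvec: "n \<le> l \<Longrightarrow> sub_orthonormal H ip {..<n} emp_eigenvec"
  by standard (auto simp: emp_eigenvec_mem ip_emp_eigenvec_emp_eigenvec)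

sublocale emp: sub_orthonormal H ip "{..<s}" emp_eigenvec
  by (rule sub_orthonormal_emp_eigenvec) (rule rank_le)

text \<open>By the reproducing property the inner product of \<open>k x\<close> with
  \<open>emp_eigenvec j\<close> is \<open>emp_eigenvec j x\<close>, and the squares of these values
  are the terms of the Nystroem sum. Indices with \<open>lam i = 0\<close> contribute nothing, as
  \<open>1 / 0 = 0\<close>.\<close>

lemma residual_kernel: "emp.residual (k x) (k x) = k x x - nystrom k l Z U lam s x x"
proof -
  have U: "U \<in> carrier_mat l l" using spectral by (simp add: spectral_decomp_def)
  have *: "emp_eigenvec i x * emp_eigenvec i x
      = 1 / lam i * (col U i \<bullet> kernel_vec k l Z x) * (col U i \<bullet> kernel_vec k l Z x)" if "i < s" for i
  proof -
    have "col U i \<bullet> kernel_vec k l Z x = (\<Sum>a<l. U $$ (a, i) * k (Z a) x)"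
      using that rank_le U by (simp add: scalar_prod_def kernel_vec_def lessThan_atLeast0)
    moreover have "emp_eigenvec i x = (\<Sum>a<l. U $$ (a, i) * k (Z a) x) / sqrt (lam i)"
      by (simp add: emp_eigenvec_def sum_divide_distrib)
    moreover have "sqrt (lam i) * sqrt (lam i) = lam i"
      using lam_nonneg[of i] that rank_le by simp
    ultimately show ?thesis by (metis times_divide_times_eq times_divide_eq_left mult_1)
  qed
  have "(\<Sum>i<s. emp_eigenvec i x * emp_eigenvec i x)
      = (\<Sum>i<s. 1 / lam i * (col U i \<bullet> kernel_vec k l Z x) * (col U i \<bullet> kernel_vec k l Z x))"
    by (rule sum.cong) (simp_all add: *)
  also have "\<dots> = nystrom k l Z U lam s x x"
    unfolding nystrom_eq_sum[OF spectral rank_le]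
  proof (rule sum.mono_neutral_right)
    show "\<forall>i\<in>{..<s} - {i. i < s \<and> lam i > 0}.
        1 / lam i * (col U i \<bullet> kernel_vec k l Z x) * (col U i \<bullet> kernel_vec k l Z x) = 0"
    proof
      fix i assume "i \<in> {..<s} - {i. i < s \<and> lam i > 0}"
      then have "lam i = 0" using lam_nonneg[of i] rank_le by auto
      then show "1 / lam i * (col U i \<bullet> kernel_vec k l Z x) * (col U i \<bullet> kernel_vec k l Z x) = 0"
        by simp
    qed
  qed auto
  finally show ?thesis
    unfolding emp.residual_def
    by (simp add: reproducing[OF kernel_mem] reproducing'[OF emp_eigenvec_mem])
qed

section \<open>Ky Fan's maximum principle on the sample\<close>

text \<open>Subtract the \<open>s\<close>-th largest value \<open>c = lam (s - 1)\<close> from every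
  \<open>lam j\<close>: the terms with \<open>j < s\<close> become nonnegative and are largest at
  weight \<open>1\<close>, the others nonpositive and largest at weight \<open>0\<close>. The
  subtracted part is controlled by the total weight, because \<open>c \<ge> 0\<close>.\<close>

lemma sum_weighted_le:
  fixes w :: "nat \<Rightarrow> real"
  assumes w: "\<And>j. j < l \<Longrightarrow> 0 \<le> w j" "\<And>j. j < l \<Longrightarrow> w j \<le> 1" and sum_w: "(\<Sum>j<l. w j) \<le> real s"
  shows "(\<Sum>j<l. lam j * w j) \<le> (\<Sum>j<s. lam j)"
proof -
  define c where "c = lam (s - 1)"
  have c: "0 \<le> c" unfolding c_def using rank_pos rank_le by (intro lam_nonneg) simp
  have "(\<Sum>j<l. (lam j - c) * w j) \<le> (\<Sum>j<l. if j < s then lam j - c else 0)"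
  proof (rule sum_mono)
    fix j assume j: "j \<in> {..<l}"
    show "(lam j - c) * w j \<le> (if j < s then lam j - c else 0)"
    proof (cases "j < s")
      case True
      then have "0 \<le> lam j - c"
        unfolding c_def using lam_antimono[of j "s - 1"] rank_le rank_pos by simp
      then show ?thesis using True w j by (simp add: mult_left_le)
    next
      case False
      then have "lam j - c \<le> 0"
        unfolding c_def using lam_antimono[of "s - 1" j] j by simp
      then show ?thesis using False w j by (simp add: mult_nonpos_nonneg)
    qed
  qed
  also have "\<dots> = (\<Sum>j<s. lam j - c)"
    by (rule sum.mono_neutral_cong_right) (use rank_le in auto)
  also have "\<dots> = (\<Sum>j<s. lam j) - real s * c" by (simp add: sum_subtractf)
  finally have "(\<Sum>j<l. lam j * w j) - c * (\<Sum>j<l. w j) \<le> (\<Sum>j<s. lam j) - real s * c"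
    by (simp add: left_diff_distrib sum_subtractf sum_distrib_left)
  moreover have "c * (\<Sum>j<l. w j) \<le> c * real s"
    by (rule mult_left_mono[OF sum_w c])
  ultimately show ?thesis by (simp add: mult.commute)
qed

text \<open>With \<open>C\<close> the empirical covariance operator, the left side is the sum of
  \<open>ip (C (\<phi> i)) (\<phi> i)\<close> over \<open>i < s\<close>. Expanding in eigenvectors
  of \<open>C\<close> turns it into a weighted sum of the \<open>lam j\<close>, and Bessel's
  inequality in both directions bounds the weights.\<close>

lemma sum_features_le: "(\<Sum>a<l. \<Sum>i<s. (\<phi> i (Z a))\<^sup>2) \<le> (\<Sum>j<s. lam j)"
proof -
  interpret all: sub_orthonormal H ip "{..<l}" emp_eigenvec
    by (rule sub_orthonormal_emp_eigenvec) simp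
  have *: "(\<Sum>a<l. (\<phi> i (Z a))\<^sup>2) = (\<Sum>j<l. lam j * (ip (\<phi> i) (emp_eigenvec j))\<^sup>2)" for i
  proof -
    have "(\<Sum>a<l. U $$ (a, j) * \<phi> i (Z a))\<^sup>2 = lam j * (ip (\<phi> i) (emp_eigenvec j))\<^sup>2" if "j < l" for j
    proof (cases "lam j = 0")
      case True
      \<comment> \<open>For \<open>lam j = 0\<close> the vector \<open>emp_eigenvec j\<close> is
        zero, so its unnormalised version \<open>h\<close> is used: it vanishes at every sample
        point, hence has norm zero and is orthogonal to \<open>\<phi> i\<close>.\<close>
      define h where "h = (\<lambda>x. \<Sum>a<l. U $$ (a, j) * k (Z a) x)"
      have h: "h \<in> H" unfolding h_def by (rule sum_mem[OF kernel_mem])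
      have ip_h: "ip f h = (\<Sum>a<l. U $$ (a, j) * f (Z a))" if "f \<in> H" for f
        unfolding h_def by (subst sum_right[OF kernel_mem that]) (simp add: reproducing[OF that])
      have "h (Z b) = 0" if "b < l" for b
        unfolding h_def using gram_eigenvec[OF \<open>j < l\<close> that] True by simp
      then have "ip h h = 0" by (simp add: ip_h[OF h])
      then have "ip (\<phi> i) h = 0"
        using cauchy_schwarz[OF feature_mem h, of i] by simp
      then show ?thesis using True by (simp add: ip_h[OF feature_mem])
    next
      case False
      then show ?thesis
        using lam_nonneg[OF that] by (simp add: ip_emp_eigenvec[OF feature_mem] power_divide)
    qed
    then have "(\<Sum>j<l. lam j * (ip (\<phi> i) (emp_eigenvec j))\<^sup>2)
        = (\<Sum>j<l. (\<Sum>a<l. U $$ (a, j) * \<phi> i (Z a)) * (\<Sum>b<l. U $$ (b, j) * \<phi> i (Z b)))"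
      by (intro sum.cong) (simp_all add: power2_eq_square)
    also have "\<dots> = (\<Sum>j<l. \<Sum>a<l. \<Sum>b<l. \<phi> i (Z a) * \<phi> i (Z b) * (U $$ (a, j) * U $$ (b, j)))"
      by (simp add: sum_product ac_simps)
    also have "\<dots> = (\<Sum>a<l. \<Sum>b<l. \<Sum>j<l. \<phi> i (Z a) * \<phi> i (Z b) * (U $$ (a, j) * U $$ (b, j)))"
      by (subst sum.swap) (intro sum.cong refl sum.swap)
    also have "\<dots> = (\<Sum>a<l. \<Sum>b<l. if a = b then (\<phi> i (Z a))\<^sup>2 else 0)"
      by (intro sum.cong refl)
        (auto simp: sum_distrib_left[symmetric] spectral_decomp_gram_mat(2)[OF spectral] power2_eq_square)
    finally show ?thesis by simp
  qed
  define w where "w j = (\<Sum>i<s. (ip (\<phi> i) (emp_eigenvec j))\<^sup>2)" for j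
  have "(\<Sum>a<l. \<Sum>i<s. (\<phi> i (Z a))\<^sup>2) = (\<Sum>i<s. \<Sum>j<l. lam j * (ip (\<phi> i) (emp_eigenvec j))\<^sup>2)"
    unfolding *[symmetric] by (rule sum.swap)
  also have "\<dots> = (\<Sum>j<l. lam j * w j)"
    unfolding w_def sum_distrib_left by (rule sum.swap)
  also have "\<dots> \<le> (\<Sum>j<s. lam j)"
  proof (rule sum_weighted_le)
    show "0 \<le> w j" for j by (simp add: w_def sum_nonneg)
    \<comment> \<open>Here Bessel's inequality is applied to the features; for the total weight it
      is applied to all \<open>l\<close> empirical eigenvectors.\<close>
    show "w j \<le> 1" if "j < l" for j
    proof -
      have "w j = (\<Sum>i<s. (ip (emp_eigenvec j) (\<phi> i))\<^sup>2)"
        unfolding w_def by (simp only: ip_commute[OF feature_mem emp_eigenvec_mem])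
      also have "\<dots> \<le> ip (emp_eigenvec j) (emp_eigenvec j)"
        by (rule \<phi>.bessel[OF emp_eigenvec_mem])
      also have "\<dots> \<le> 1" using that by (rule all.norm_le[OF lessThan_iff[THEN iffD2]])
      finally show ?thesis .
    qed
    have "(\<Sum>j<l. w j) = (\<Sum>i<s. \<Sum>j<l. (ip (\<phi> i) (emp_eigenvec j))\<^sup>2)"
      unfolding w_def by (rule sum.swap)
    also have "\<dots> \<le> (\<Sum>i<s. 1)"
      by (intro sum_mono order.trans[OF all.bessel[OF feature_mem] feature_norm_le])
    finally show "(\<Sum>j<l. w j) \<le> real s" by simp
  qed
  finally show ?thesis .
qed

text \<open>The empirical eigenvectors attain Ky Fan's maximum: their squared values on the sample
  sum to exactly the top \<open>s\<close> eigenvalues.\<close>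

lemma sum_residual_sample_le:
  "(\<Sum>a<l. k (Z a) (Z a) - nystrom k l Z U lam s (Z a) (Z a))
     \<le> (\<Sum>a<l. k (Z a) (Z a) - (\<Sum>i<s. (\<phi> i (Z a))\<^sup>2))"
proof -
  have "(\<Sum>a<l. \<Sum>j<s. (emp_eigenvec j (Z a))\<^sup>2) = (\<Sum>j<s. \<Sum>a<l. lam j * (U $$ (a, j) * U $$ (a, j)))"
    unfolding sum.swap[of _ "{..<s}"]
    by (intro sum.cong refl) (use rank_le lam_nonneg in
        \<open>auto simp: emp_eigenvec_sample power_mult_distrib power2_eq_square\<close>)
  also have "\<dots> = (\<Sum>j<s. lam j)"
    unfolding sum_distrib_left[symmetric]
    by (intro sum.cong refl) (use rank_le in \<open>simp add: spectral_decomp_gram_mat(1)[OF spectral]\<close>)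
  finally have "(\<Sum>a<l. \<Sum>j<s. (emp_eigenvec j (Z a))\<^sup>2) = (\<Sum>j<s. lam j)" .
  then show ?thesis
    using sum_features_le
    by (simp add: residual_kernel[symmetric] emp.residual_def sum_subtractf
        reproducing[OF kernel_mem] reproducing'[OF emp_eigenvec_mem] power2_eq_square)
qed

section \<open>Approximation of the residual by a quadratic form in \<open>m\<close>
  features\<close>

lemma residual_bounds:
  "0 \<le> k x x - nystrom k l Z U lam s x x"
  "k x x - nystrom k l Z U lam s x x \<le> k x x"
proof -
  interpret res: semi_inner H emp.residual by (rule emp.semi_inner_residual)
  show "0 \<le> k x x - nystrom k l Z U lam s x x"
    using res.nonneg[OF kernel_mem, of x] by (simp add: residual_kernel)
  show "k x x - nystrom k l Z U lam s x x \<le> k x x"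
    using emp.residual_le[of "k x"] by (simp add: residual_kernel reproducing[OF kernel_mem])
qed

text \<open>Split \<open>k x = p + r\<close>, where \<open>p\<close> is the expansion of
  \<open>k x\<close> in the first \<open>m\<close> features. The residual form at \<open>p\<close>
  is the double sum, at \<open>r\<close> it is at most \<open>t x\<close>, and the triangle
  inequality compares the square roots.\<close>

lemma residual_approx:
  fixes m :: nat
  defines "A \<equiv> \<lambda>i j. emp.residual (\<phi> i) (\<phi> j)"
    and "t \<equiv> \<lambda>x. k x x - (\<Sum>i<m. (\<phi> i x)\<^sup>2)"
    and "g \<equiv> \<lambda>x. sqrt (k x x - nystrom k l Z U lam s x x)"
  shows "\<bar>A i j\<bar> \<le> 1"
    and "0 \<le> (\<Sum>i<m. \<Sum>j<m. \<phi> i x * \<phi> j x * A i j)"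
    and "(\<Sum>i<m. \<Sum>j<m. \<phi> i x * \<phi> j x * A i j) \<le> k x x"
    and "g x \<le> sqrt (\<Sum>i<m. \<Sum>j<m. \<phi> i x * \<phi> j x * A i j) + sqrt (t x)"
    and "sqrt (\<Sum>i<m. \<Sum>j<m. \<phi> i x * \<phi> j x * A i j) \<le> g x + sqrt (t x)"
proof -
  interpret res: semi_inner H emp.residual by (rule emp.semi_inner_residual)
  have "emp.residual (\<phi> i) (\<phi> i) \<le> 1" for i
    by (rule order.trans[OF emp.residual_le feature_norm_le])
  then show "\<bar>A i j\<bar> \<le> 1"
    unfolding A_def by (intro res.abs_le_one feature_mem)
  define p where "p = (\<lambda>y. \<Sum>i<m. \<phi> i x * \<phi> i y)"
  define r where "r = (\<lambda>y. k x y + (- 1) * p y)"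
  have p: "p \<in> H" unfolding p_def by (rule sum_mem[OF feature_mem])
  have r: "r \<in> H" unfolding r_def by (rule add_mem[OF kernel_mem scale_mem[OF p]])
  have "emp.residual p p = (\<Sum>i<m. \<phi> i x * emp.residual (\<phi> i) p)"
    unfolding p_def by (rule res.sum_left[OF feature_mem p[unfolded p_def]])
  also have "\<dots> = (\<Sum>i<m. \<phi> i x * (\<Sum>j<m. \<phi> j x * A i j))"
    unfolding p_def A_def by (subst res.sum_right[OF feature_mem feature_mem]) (rule refl)
  finally have pp: "emp.residual p p = (\<Sum>i<m. \<Sum>j<m. \<phi> i x * \<phi> j x * A i j)"
    by (simp add: sum_distrib_left mult.assoc)
  have ip_kx: "ip (k x) (\<phi> i) = \<phi> i x" for i by (rule reproducing'[OF feature_mem])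
  have rr: "emp.residual r r \<le> t x"
    using \<phi>.norm_diff_le[OF kernel_mem, of x m] emp.residual_le[of r]
    unfolding r_def p_def t_def ip_kx reproducing[OF kernel_mem] by simp
  have "ip p p \<le> (\<Sum>i<m. (\<phi> i x)\<^sup>2)" unfolding p_def by (rule \<phi>.norm_sum_le)
  moreover have "(\<Sum>i<m. (\<phi> i x)\<^sup>2) \<le> k x x"
    using \<phi>.bessel[OF kernel_mem, of x m] unfolding ip_kx reproducing[OF kernel_mem] .
  ultimately show "(\<Sum>i<m. \<Sum>j<m. \<phi> i x * \<phi> j x * A i j) \<le> k x x"
    unfolding pp[symmetric] using emp.residual_le[of p] by linarith
  show "0 \<le> (\<Sum>i<m. \<Sum>j<m. \<phi> i x * \<phi> j x * A i j)"
    unfolding pp[symmetric] by (rule res.nonneg[OF p])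
  have g: "g x = sqrt (emp.residual (k x) (k x))" by (simp add: g_def residual_kernel)
  have "(\<lambda>y. p y + r y) = k x" by (simp add: r_def fun_eq_iff)
  from res.triangle[OF p r, unfolded this] real_sqrt_le_mono[OF rr]
  show "g x \<le> sqrt (\<Sum>i<m. \<Sum>j<m. \<phi> i x * \<phi> j x * A i j) + sqrt (t x)"
    unfolding g pp[symmetric] by linarith
  \<comment> \<open>The reverse comparison writes \<open>p\<close> as \<open>k x\<close> plus
    \<open>r'\<close>.\<close>
  define r' where "r' = (\<lambda>y. (- 1) * r y)"
  have r': "r' \<in> H" unfolding r'_def by (rule scale_mem[OF r])
  have "emp.residual r' r' = emp.residual r r"
    unfolding r'_def res.scale_left[OF r scale_mem[OF r]] res.scale_right[OF r r] by simp
  with real_sqrt_le_mono[OF rr] have "sqrt (emp.residual r' r') \<le> sqrt (t x)" by simp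
  moreover have "(\<lambda>y. k x y + r' y) = p" by (simp add: r_def r'_def fun_eq_iff)
  from res.triangle[OF kernel_mem r', of x, unfolded this]
  have "sqrt (emp.residual p p) \<le> sqrt (emp.residual (k x) (k x)) + sqrt (emp.residual r' r')" .
  ultimately show "sqrt (\<Sum>i<m. \<Sum>j<m. \<phi> i x * \<phi> j x * A i j) \<le> g x + sqrt (t x)"
    unfolding g pp[symmetric] by linarith
qed

end

section \<open>A multiplicative uniform deviation bound\<close>

text \<open>On \<open>[0, 1]\<close> the product \<open>(1 - u / 2) * (1 + u)\<close> is at least
  \<open>1\<close>, and \<open>1 + u \<le> exp u\<close>.\<close>

lemma exp_minus_le:
  fixes u :: real
  assumes "0 \<le> u" "u \<le> 1"
  shows "exp (- u) \<le> 1 - u / 2"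
proof -
  have "1 \<le> (1 - u / 2) * (1 + u)"
    using mult_right_le_one_le[of u u] assms by (simp add: field_simps)
  also have "\<dots> \<le> (1 - u / 2) * exp u"
    using assms exp_ge_add_one_self[of u] by (intro mult_left_mono) auto
  finally show ?thesis by (simp add: exp_minus field_simps)
qed

context
  fixes M :: "'a measure" and l :: nat
  assumes M: "prob_space M"
begin

lemma integral_sample_component:
  fixes h :: "'a \<Rightarrow> real"
  assumes h: "integrable M h" and a: "a < l"
  shows "integrable (\<Pi>\<^sub>M i\<in>{..<l}. M) (\<lambda>Z. h (Z a))"
    and "(\<integral>Z. h (Z a) \<partial>(\<Pi>\<^sub>M i\<in>{..<l}. M)) = (\<integral>x. h x \<partial>M)"
proof -
  have d: "distr (\<Pi>\<^sub>M i\<in>{..<l}. M) M (\<lambda>Z. Z a) = M"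
    using a M by (intro distr_PiM_component) auto
  have m: "(\<lambda>Z. Z a) \<in> measurable (\<Pi>\<^sub>M i\<in>{..<l}. M) M"
    using a by simp
  show "integrable (\<Pi>\<^sub>M i\<in>{..<l}. M) (\<lambda>Z. h (Z a))"
    using h by (intro integrable_distr[OF m]) (simp add: d)
  show "(\<integral>Z. h (Z a) \<partial>(\<Pi>\<^sub>M i\<in>{..<l}. M)) = (\<integral>x. h x \<partial>M)"
    using integral_distr[OF m, of h] h unfolding d by simp
qed

lemma integral_sample_average:
  fixes h :: "'a \<Rightarrow> real"
  assumes h: "integrable M h" and l: "0 < l"
  shows "integrable (\<Pi>\<^sub>M i\<in>{..<l}. M) (\<lambda>Z. (\<Sum>a<l. h (Z a)) / real l)"
    and "(\<integral>Z. (\<Sum>a<l. h (Z a)) / real l \<partial>(\<Pi>\<^sub>M i\<in>{..<l}. M)) = (\<integral>x. h x \<partial>M)"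
  using l integral_sample_component[OF h]
  by (auto intro!: integrable_divide Bochner_Integration.integrable_sum simp: Bochner_Integration.integral_sum)

text \<open>This is Jensen's inequality, obtained from the nonnegative variance of
  \<open>sqrt (f x)\<close>; integrability comes from \<open>sqrt y \<le> 1 + y\<close>.\<close>

lemma integral_sqrt_le:
  assumes f: "integrable M f" and nonneg: "\<And>x. x \<in> space M \<Longrightarrow> 0 \<le> f x"
  shows "integrable M (\<lambda>x. sqrt (f x))" and "(\<integral>x. sqrt (f x) \<partial>M) \<le> sqrt (\<integral>x. f x \<partial>M)"
proof -
  interpret prob_space M by (rule M)
  have "sqrt y \<le> 1 + y" if "0 \<le> y" for y :: real
    using that by (intro real_le_lsqrt) (auto simp: power2_eq_square algebra_simps)
  then have "AE x in M. norm (sqrt (f x)) \<le> norm (1 + f x)"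
    using nonneg by (intro AE_I2) auto
  then show i: "integrable M (\<lambda>x. sqrt (f x))"
    by (rule Bochner_Integration.integrable_bound[rotated 2]) (use f in auto)
  define c where "c = (\<integral>x. sqrt (f x) \<partial>M)"
  have "0 \<le> (\<integral>x. (sqrt (f x) - c)\<^sup>2 \<partial>M)" by (rule integral_nonneg_AE) simp
  also have "\<dots> = (\<integral>x. f x - 2 * c * sqrt (f x) + c\<^sup>2 \<partial>M)"
    using nonneg by (intro Bochner_Integration.integral_cong) (auto simp: power2_diff)
  also have "\<dots> = (\<integral>x. f x \<partial>M) - 2 * c * c + c\<^sup>2"
    using f i by (simp add: prob_space c_def)
  finally have "c\<^sup>2 \<le> (\<integral>x. f x \<partial>M)" by (simp add: power2_eq_square)
  then show "(\<integral>x. sqrt (f x) \<partial>M) \<le> sqrt (\<integral>x. f x \<partial>M)"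
    unfolding c_def by (rule real_le_rsqrt)
qed

text \<open>The factor \<open>2\<close> in front of the empirical mean makes the exponential moment at most \<open>1\<close>,
  since \<open>exp (- f / b)\<close> has expectation at most \<open>exp (- \<mu> f / (2 * b))\<close>.\<close>

lemma exp_deviation_le:
  assumes f[measurable]: "f \<in> borel_measurable M" and f0: "\<And>x. 0 \<le> f x" and fb: "\<And>x. f x \<le> b"
    and b: "0 < b" and l: "0 < l"
  defines "X \<equiv> \<lambda>Z. real l / (2 * b) * ((\<integral>x. f x \<partial>M) - 2 * ((\<Sum>a<l. f (Z a)) / real l))"
  shows "integrable (\<Pi>\<^sub>M i\<in>{..<l}. M) (\<lambda>Z. exp (X Z))"
    and "(\<integral>Z. exp (X Z) \<partial>(\<Pi>\<^sub>M i\<in>{..<l}. M)) \<le> 1"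
proof -
  interpret prob_space M by (rule M)
  interpret P: product_prob_space "\<lambda>_. M" "{..<l}" by standard
  define c where "c = (\<integral>x. f x \<partial>M)"
  have f_int: "integrable M f"
    using f0 fb by (intro integrable_const_bound[of _ b]) auto
  have e_int: "integrable M (\<lambda>x. exp (- f x / b))"
    using f0 b by (intro integrable_const_bound[of _ 1]) auto
  \<comment> \<open>The scale \<open>l / (2 * b)\<close> turns the doubled empirical mean into
    exponents \<open>- f (Z a) / b\<close>, with \<open>f / b\<close> in \<open>[0, 1]\<close> as
    \<open>exp_minus_le\<close> requires.\<close>
  have X: "exp (X Z) = exp (real l * c / (2 * b)) * (\<Prod>a<l. exp (- f (Z a) / b))" for Z
  proof -
    have "X Z = real l * c / (2 * b) + (\<Sum>a<l. - f (Z a) / b)"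
      using l b by (simp add: X_def c_def sum_negf sum_divide_distrib[symmetric] field_simps)
    then show ?thesis by (simp add: exp_add exp_sum)
  qed
  show "integrable (\<Pi>\<^sub>M i\<in>{..<l}. M) (\<lambda>Z. exp (X Z))"
    unfolding X by (intro integrable_mult_right P.product_integrable_prod e_int) simp
  have "(\<integral>x. exp (- f x / b) \<partial>M) \<le> (\<integral>x. 1 - f x / b / 2 \<partial>M)"
    using f0 fb b f_int exp_minus_le[of "f _ / b"]
    by (intro integral_mono e_int) auto
  also have "\<dots> = 1 - c / b / 2"
    using f_int by (simp add: prob_space c_def)
  also have "\<dots> \<le> exp (- (c / (2 * b)))"
    using exp_ge_add_one_self[of "- (c / (2 * b))"] by simp
  finally have *: "(\<integral>x. exp (- f x / b) \<partial>M) \<le> exp (- (c / (2 * b)))" .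
  have "(\<integral>Z. exp (X Z) \<partial>(\<Pi>\<^sub>M i\<in>{..<l}. M))
      = exp (real l * c / (2 * b)) * (\<Prod>a<l. \<integral>x. exp (- f x / b) \<partial>M)"
    unfolding X by (subst P.product_integral_prod[OF _ e_int, symmetric]) simp_all
  also have "\<dots> \<le> exp (real l * c / (2 * b)) * (\<Prod>a<l. exp (- (c / (2 * b))))"
    by (intro mult_left_mono prod_mono conjI * integral_nonneg_AE) auto
  \<comment> \<open>The product of the \<open>l\<close> factors is the reciprocal of the
    prefactor.\<close>
  also have "\<dots> = 1"
    by (simp add: exp_of_nat_mult[symmetric] exp_add[symmetric])
  finally show "(\<integral>Z. exp (X Z) \<partial>(\<Pi>\<^sub>M i\<in>{..<l}. M)) \<le> 1" .
qed

text \<open>With \<open>N = card J\<close>, the bound \<open>y \<le> ln N - 1 + exp y / N\<close> replaces the maximum over \<open>J\<close>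
  by a sum of exponentials.\<close>

lemma uniform_deviation:
  fixes f :: "'i \<Rightarrow> 'a \<Rightarrow> real"
  assumes J: "finite J" "J \<noteq> {}"
    and f: "\<And>j. j \<in> J \<Longrightarrow> f j \<in> borel_measurable M"
    and f0: "\<And>j x. 0 \<le> f j x" and fb: "\<And>j x. f j x \<le> b"
    and b: "0 < b" and l: "0 < l"
  obtains D where "integrable (\<Pi>\<^sub>M i\<in>{..<l}. M) D"
    and "(\<integral>Z. D Z \<partial>(\<Pi>\<^sub>M i\<in>{..<l}. M)) \<le> 2 * b * ln (real (card J)) / real l"
    and "\<And>Z j. j \<in> J \<Longrightarrow> (\<integral>x. f j x \<partial>M) \<le> 2 * ((\<Sum>a<l. f j (Z a)) / real l) + D Z"
proof
  interpret P: prob_space "\<Pi>\<^sub>M i\<in>{..<l}. M" by (rule prob_space_PiM) (rule M)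
  define N where "N = real (card J)"
  have N: "0 < N" using J by (simp add: N_def card_gt_0_iff)
  define X where "X j Z = real l / (2 * b) * ((\<integral>x. f j x \<partial>M) - 2 * ((\<Sum>a<l. f j (Z a)) / real l))" for j Z
  \<comment> \<open>One function of the sample serves all \<open>j\<close>, so that \<open>j\<close>
    may later be chosen depending on \<open>Z\<close>.\<close>
  define D where "D Z = 2 * b / real l * (ln N - 1 + (\<Sum>j\<in>J. exp (X j Z)) / N)" for Z
  have X: "integrable (\<Pi>\<^sub>M i\<in>{..<l}. M) (\<lambda>Z. exp (X j Z))"
      "(\<integral>Z. exp (X j Z) \<partial>(\<Pi>\<^sub>M i\<in>{..<l}. M)) \<le> 1" if "j \<in> J" for j
    unfolding X_def using exp_deviation_le[OF f[OF that] f0 fb b l] by auto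
  show "integrable (\<Pi>\<^sub>M i\<in>{..<l}. M) D"
    unfolding D_def using X by (intro integrable_mult_right Bochner_Integration.integrable_add
        integrable_divide Bochner_Integration.integrable_sum) auto
  have "(\<integral>Z. D Z \<partial>(\<Pi>\<^sub>M i\<in>{..<l}. M))
      = 2 * b / real l * (ln N - 1 + (\<Sum>j\<in>J. \<integral>Z. exp (X j Z) \<partial>(\<Pi>\<^sub>M i\<in>{..<l}. M)) / N)"
    unfolding D_def using X by (simp add: P.prob_space)
  also have "\<dots> \<le> 2 * b / real l * (ln N - 1 + (\<Sum>j\<in>J. 1) / N)"
    using b N X by (intro mult_left_mono add_left_mono divide_right_mono sum_mono) auto
  also have "\<dots> = 2 * b * ln N / real l" using N by (simp add: N_def)
  finally show "(\<integral>Z. D Z \<partial>(\<Pi>\<^sub>M i\<in>{..<l}. M)) \<le> 2 * b * ln (real (card J)) / real l"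
    unfolding N_def .
  show "(\<integral>x. f j x \<partial>M) \<le> 2 * ((\<Sum>a<l. f j (Z a)) / real l) + D Z" if j: "j \<in> J" for Z j
  proof -
    have "X j Z - ln N \<le> exp (X j Z - ln N) - 1"
      using exp_ge_add_one_self[of "X j Z - ln N"] by linarith
    also have "exp (X j Z - ln N) = exp (X j Z) / N" using N by (simp add: exp_diff)
    also have "\<dots> \<le> (\<Sum>j\<in>J. exp (X j Z)) / N"
      using N J j by (intro divide_right_mono member_le_sum) auto
    finally have "2 * b / real l * X j Z \<le> D Z"
      unfolding D_def using b by (intro mult_left_mono) auto
    moreover have "2 * b / real l * X j Z = (\<integral>x. f j x \<partial>M) - 2 * ((\<Sum>a<l. f j (Z a)) / real l)"
      unfolding X_def using b l by simp
    ultimately show ?thesis by linarith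
  qed
qed

end

section \<open>Rounding to a finite class of functions\<close>

lemma average_sqrt_le:
  fixes c :: "nat \<Rightarrow> real"
  assumes "\<And>a. a < l \<Longrightarrow> 0 \<le> c a"
  shows "(\<Sum>a<l. sqrt (c a)) / real l \<le> sqrt ((\<Sum>a<l. c a) / real l)"
proof (rule real_le_rsqrt)
  have "(\<Sum>a<l. sqrt (c a))\<^sup>2 \<le> real l * (\<Sum>a<l. (sqrt (c a))\<^sup>2)"
    using sum_squared_le_sum_of_squares[of "\<lambda>a. sqrt (c a)" "{..<l}"] by (simp add: mult.commute)
  also have "(\<Sum>a<l. (sqrt (c a))\<^sup>2) = (\<Sum>a<l. c a)"
    using assms by (intro sum.cong) auto
  finally show "((\<Sum>a<l. sqrt (c a)) / real l)\<^sup>2 \<le> (\<Sum>a<l. c a) / real l"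
    by (cases "l = 0") (simp_all add: power_divide power2_eq_square field_simps)
qed

text \<open>Square roots are subadditive, so a perturbation of size \<open>c\<^sup>2\<close> moves
  the root by at most \<open>c\<close>. The \<open>max 0 y\<close> allows for a rounded form that
  has become negative.\<close>

lemma abs_sqrt_diff_le:
  assumes "0 \<le> x" "\<bar>x - y\<bar> \<le> c\<^sup>2" "0 \<le> c"
  shows "\<bar>sqrt x - sqrt (max 0 y)\<bar> \<le> c"
proof -
  have *: "sqrt u \<le> sqrt v + c" if "u \<le> v + c\<^sup>2" "0 \<le> v" for u v
  proof -
    have "sqrt u \<le> sqrt (v + c\<^sup>2)" using that by simp
    also have "\<dots> \<le> sqrt v + sqrt (c\<^sup>2)" using that by (intro sqrt_add_le_add_sqrt) auto
    finally show ?thesis using assms by simp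
  qed
  have "sqrt x \<le> sqrt (max 0 y) + c" "sqrt (max 0 y) \<le> sqrt x + c"
    using assms by (intro *; auto)+
  then show ?thesis by (simp add: abs_le_iff)
qed

text \<open>The entrywise error is multiplied by
  \<open>(\<Sum>i<m. \<bar>u i\<bar>)\<^sup>2\<close>, which Cauchy-Schwarz bounds by
  \<open>m\<close> times the sum of squares.\<close>

lemma quadratic_form_perturbation:
  fixes u :: "nat \<Rightarrow> real"
  assumes "\<And>i j. i < m \<Longrightarrow> j < m \<Longrightarrow> \<bar>A i j - B i j\<bar> \<le> \<delta>" and "0 \<le> \<delta>"
  shows "\<bar>(\<Sum>i<m. \<Sum>j<m. u i * u j * A i j) - (\<Sum>i<m. \<Sum>j<m. u i * u j * B i j)\<bar>
      \<le> \<delta> * real m * (\<Sum>i<m. (u i)\<^sup>2)"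
proof -
  have "(\<Sum>i<m. \<Sum>j<m. u i * u j * A i j) - (\<Sum>i<m. \<Sum>j<m. u i * u j * B i j)
      = (\<Sum>i<m. \<Sum>j<m. u i * u j * (A i j - B i j))"
    by (simp add: sum_subtractf right_diff_distrib)
  also have "\<bar>\<dots>\<bar> \<le> (\<Sum>i<m. \<Sum>j<m. \<bar>u i * u j * (A i j - B i j)\<bar>)"
    by (rule order.trans[OF sum_abs sum_mono[OF sum_abs]])
  also have "\<dots> \<le> (\<Sum>i<m. \<Sum>j<m. \<bar>u i\<bar> * \<bar>u j\<bar> * \<delta>)"
    using assms by (intro sum_mono) (auto simp: abs_mult intro!: mult_left_mono)
  also have "\<dots> = \<delta> * (\<Sum>i<m. \<bar>u i\<bar>)\<^sup>2"
    by (simp add: power2_eq_square sum_product sum_distrib_left mult.commute)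
  also have "\<dots> \<le> \<delta> * ((\<Sum>i<m. \<bar>u i\<bar>\<^sup>2) * real m)"
    using sum_squared_le_sum_of_squares[of "\<lambda>i. \<bar>u i\<bar>" "{..<m}"] assms(2)
    by (intro mult_left_mono) simp_all
  finally show ?thesis by (simp add: ac_simps)
qed

text \<open>\<open>J\<close> holds the integer numerators of the grid matrices;
  \<open>\<rightarrow>\<^sub>E\<close> fixes the values off the index set, which makes
  \<open>J\<close> finite.\<close>

lemma card_grid_le:
  fixes l m :: nat
  defines "J \<equiv> ({..<m} \<times> {..<m}) \<rightarrow>\<^sub>E {- int (l ^ 3)..int (l ^ 3)}"
  shows "finite J" and "J \<noteq> {}" and "ln (real (card J)) \<le> 3 * (real m)\<^sup>2 * ln (1 + 2 * real l)"
proof -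
  show "finite J" unfolding J_def by (intro finite_PiE) auto
  show "J \<noteq> {}" by (simp add: J_def PiE_eq_empty_iff)
  have "card J = (2 * l ^ 3 + 1) ^ (m * m)"
  proof -
    have "card {- int L..int L} = 2 * L + 1" for L by simp
    then show ?thesis unfolding J_def by (simp add: card_PiE del: of_nat_power)
  qed
  then have "ln (real (card J)) = real (m * m) * ln (real (2 * l ^ 3 + 1))"
    by (subst ln_realpow[symmetric]) (simp_all only: of_nat_power of_nat_0_less_iff zero_less_Suc flip: Suc_eq_plus1)
  \<comment> \<open>Since \<open>2 * l ^ 3 + 1 \<le> (1 + 2 * l) ^ 3\<close>, the cubic resolution
    costs only the factor \<open>3\<close>.\<close>
  also have "\<dots> \<le> real (m * m) * ln ((1 + 2 * real l) ^ 3)"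
    by (intro mult_left_mono ln_mono) (simp_all add: power3_eq_cube algebra_simps add_pos_nonneg)
  also have "\<dots> = 3 * (real m)\<^sup>2 * ln (1 + 2 * real l)"
    by (simp add: ln_realpow power2_eq_square)
  finally show "ln (real (card J)) \<le> 3 * (real m)\<^sup>2 * ln (1 + 2 * real l)" .
qed

text \<open>Resolution \<open>1 / l ^ 3\<close> changes the form by at most
  \<open>m * b\<^sup>2 / l ^ 3\<close>, which is at most \<open>(b / l)\<^sup>2\<close> because
  \<open>m \<le> l\<close>; the root then moves by at most \<open>b / l\<close>. Clipping at
  \<open>b\<close> is harmless since \<open>sqrt QA \<le> b\<close>.\<close>

lemma grid_approx:
  fixes u :: "nat \<Rightarrow> real" and A :: "nat \<Rightarrow> nat \<Rightarrow> real" and m l :: nat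
  defines "QA \<equiv> \<Sum>i<m. \<Sum>j<m. u i * u j * A i j"
    and "QB \<equiv> \<Sum>i<m. \<Sum>j<m. u i * u j * (of_int \<lfloor>A i j * real (l ^ 3)\<rfloor> / real (l ^ 3))"
  assumes l: "0 < l" and m: "m \<le> l" and b: "0 \<le> b" and u: "(\<Sum>i<m. (u i)\<^sup>2) \<le> b\<^sup>2"
    and QA: "0 \<le> QA" "QA \<le> b\<^sup>2"
  shows "\<bar>sqrt QA - min b (sqrt (max 0 QB))\<bar> \<le> b / real l"
proof -
  have *: "\<bar>x - of_int \<lfloor>x * c\<rfloor> / c\<bar> \<le> 1 / c" if "0 < c" for x c :: real
  proof -
    have "\<bar>x * c - of_int \<lfloor>x * c\<rfloor>\<bar> \<le> 1"
      using of_int_floor_le[of "x * c"] real_of_int_floor_add_one_ge[of "x * c"]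
      by (simp only: abs_le_iff) linarith
    moreover have "x - of_int \<lfloor>x * c\<rfloor> / c = (x * c - of_int \<lfloor>x * c\<rfloor>) / c"
      using that by (simp add: field_simps)
    ultimately show ?thesis
      using that by (simp only: abs_divide) (simp add: divide_right_mono)
  qed
  have "\<bar>QA - QB\<bar> \<le> 1 / real (l ^ 3) * real m * (\<Sum>i<m. (u i)\<^sup>2)"
    unfolding QA_def QB_def using l by (intro quadratic_form_perturbation *) auto
  also have "\<dots> \<le> 1 / real (l ^ 3) * real l * b\<^sup>2"
    using m u by (intro mult_mono mult_left_mono) (auto simp: sum_nonneg)
  also have "\<dots> = (b / real l)\<^sup>2"
    using l by (simp add: power2_eq_square power3_eq_cube)
  finally have "\<bar>sqrt QA - sqrt (max 0 QB)\<bar> \<le> b / real l"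
    using QA b by (intro abs_sqrt_diff_le) auto
  moreover have "sqrt QA \<le> b" using QA b by (intro real_le_lsqrt) auto
  ultimately show ?thesis by (simp add: min_def abs_le_iff)
qed

section \<open>The expected residual\<close>

locale mercer_kernel = prob_space \<mu>
  for \<mu> :: "'a measure" +
  fixes k :: "'a \<Rightarrow> 'a \<Rightarrow> real" and b :: real and \<sigma> :: "nat \<Rightarrow> real" and e :: "nat \<Rightarrow> 'a \<Rightarrow> real"
  assumes eig: "eigenpairs \<mu> k \<sigma> e"
    and mercer: "\<And>x y. (\<lambda>i. \<sigma> i * e i x * e i y) sums k x y"
    and diag_le: "\<And>x. k x x \<le> b\<^sup>2"
begin

section \<open>Mercer tails and their integrals\<close>

definition feature :: "nat \<Rightarrow> 'a \<Rightarrow> real" where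
  "feature i x = sqrt (\<sigma> i) * e i x"

text \<open>By the Mercer expansion this is the sum of \<open>\<sigma> i * (e i x)\<^sup>2\<close>
  over \<open>i \<ge> n\<close>.\<close>

definition tail :: "nat \<Rightarrow> 'a \<Rightarrow> real" where
  "tail n x = k x x - (\<Sum>i<n. (feature i x)\<^sup>2)"

lemma sigma_nonneg: "0 \<le> \<sigma> i"
  using eig by (simp add: eigenpairs_def)

lemma eigenfunction_measurable [measurable]: "e i \<in> borel_measurable \<mu>"
  using eig by (simp add: eigenpairs_def L2_def)

lemma feature_measurable [measurable]: "feature i \<in> borel_measurable \<mu>"
  unfolding feature_def by measurable

lemma feature_power2: "(feature i x)\<^sup>2 = \<sigma> i * e i x * e i x"
  using sigma_nonneg[of i] by (simp add: feature_def power_mult_distrib power2_eq_square)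

lemma feature_sums: "(\<lambda>i. (feature i x)\<^sup>2) sums k x x"
  unfolding feature_power2 by (rule mercer)

text \<open>The Mercer expansion makes the diagonal a pointwise series of measurable
  functions.\<close>

lemma diag_measurable [measurable]: "(\<lambda>x. k x x) \<in> borel_measurable \<mu>"
proof -
  have "(\<lambda>x. k x x) = (\<lambda>x. \<Sum>i. (feature i x)\<^sup>2)"
    using feature_sums by (simp add: fun_eq_iff sums_iff)
  then show ?thesis by simp
qed

lemma tail_measurable [measurable]: "tail n \<in> borel_measurable \<mu>"
  unfolding tail_def by measurable

lemma feature_sum_le: "(\<Sum>i<n. (feature i x)\<^sup>2) \<le> k x x"
  using feature_sums[of x] by (metis sum_le_suminf[of _ "{..<n}"] sums_iff finite_lessThan zero_le_power2)

lemma tail_nonneg: "0 \<le> tail n x"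
  using feature_sum_le by (simp add: tail_def)

lemma tail_le: "tail n x \<le> b\<^sup>2"
  using diag_le[of x] by (simp add: tail_def add_increasing2 sum_nonneg diff_le_eq)

lemma tail_integrable: "integrable \<mu> (tail n)"
  using tail_nonneg tail_le by (intro integrable_const_bound[of _ "b\<^sup>2"]) auto

lemma integral_feature: "integrable \<mu> (\<lambda>x. (feature i x)\<^sup>2)" "(\<integral>x. (feature i x)\<^sup>2 \<partial>\<mu>) = \<sigma> i"
proof -
  have "integrable \<mu> (\<lambda>x. (e i x)\<^sup>2)" "(\<integral>x. (e i x)\<^sup>2 \<partial>\<mu>) = 1"
    using eig by (simp_all add: eigenpairs_def L2_def L2_inner_def power2_eq_square)
  then show "integrable \<mu> (\<lambda>x. (feature i x)\<^sup>2)" "(\<integral>x. (feature i x)\<^sup>2 \<partial>\<mu>) = \<sigma> i"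
    using sigma_nonneg[of i] by (simp_all add: feature_def power_mult_distrib)
qed

lemma diag_integrable: "integrable \<mu> (\<lambda>x. k x x)"
  using tail_integrable[of 0] by (simp add: tail_def[abs_def])

text \<open>Each partial sum is the integral of a partial Mercer sum on the diagonal, hence at most
  the trace \<open>\<integral>x. k x x \<partial>\<mu>\<close>.\<close>

lemma sigma_summable: "summable \<sigma>"
proof (rule summableI_nonneg_bounded)
  show "(\<Sum>i<n. \<sigma> i) \<le> (\<integral>x. k x x \<partial>\<mu>)" for n
  proof -
    have "(\<Sum>i<n. \<sigma> i) = (\<integral>x. (\<Sum>i<n. (feature i x)\<^sup>2) \<partial>\<mu>)"
      by (simp add: integral_feature)
    also have "\<dots> \<le> (\<integral>x. k x x \<partial>\<mu>)"
      by (intro integral_mono diag_integrable feature_sum_le) (simp add: integral_feature)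
    finally show ?thesis .
  qed
qed (rule sigma_nonneg)

lemma integral_tail: "(\<integral>x. tail n x \<partial>\<mu>) = (\<Sum>i. \<sigma> (i + n))"
proof -
  have "(\<integral>x. k x x \<partial>\<mu>) = (\<integral>x. (\<Sum>i. (feature i x)\<^sup>2) \<partial>\<mu>)"
    using feature_sums by (simp add: sums_iff)
  also have "\<dots> = (\<Sum>i. \<sigma> i)"
    using feature_sums
    by (subst integral_suminf) (auto simp: integral_feature sigma_summable sums_iff)
  finally show ?thesis
    unfolding tail_def suminf_minus_initial_segment[OF sigma_summable]
    by (subst Bochner_Integration.integral_diff) (auto simp: diag_integrable integral_feature)
qed

lemma integral_sqrt_tail:
  "integrable \<mu> (\<lambda>x. sqrt (tail n x))" "(\<integral>x. sqrt (tail n x) \<partial>\<mu>) \<le> sqrt (\<Sum>i. \<sigma> (i + n))"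
  using integral_sqrt_le[OF prob_space_axioms tail_integrable[of n] tail_nonneg]
  by (simp_all add: integral_tail)

text \<open>Passing from the residual to a grid function under \<open>\<mu>\<close> costs
  \<open>\<tau> + b / l\<close> once; passing back under the doubled empirical mean costs it twice.
  This gives both constants \<open>3\<close>. The \<open>6\<close> is \<open>2 * 3\<close>, from the
  deviation bound and \<open>card_grid_le\<close>; the leading \<open>2\<close> is the factor at the
  empirical mean.\<close>

lemma expected_residual_le:
  fixes H ip and l s m :: nat and U :: "(nat \<Rightarrow> 'a) \<Rightarrow> real mat" and lam
  assumes features: "\<And>Z. Z \<in> space (\<Pi>\<^sub>M i\<in>{..<l}. \<mu>) \<Longrightarrow>
      nystrom_features k H ip feature l s Z (U Z) (lam Z)"
    and b: "0 < b" and l: "0 < l" and m: "m \<le> l"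
  shows "(\<integral>Z. (\<integral>x. sqrt (k x x - nystrom k l Z (U Z) (lam Z) s x x) \<partial>\<mu>) \<partial>(\<Pi>\<^sub>M i\<in>{..<l}. \<mu>))
    \<le> 2 * sqrt (\<Sum>i. \<sigma> (i + s)) + 3 * sqrt (\<Sum>i. \<sigma> (i + m))
       + b / real l * (6 * (real m)\<^sup>2 * ln (1 + 2 * real l) + 3)"
proof -
  let ?P = "\<Pi>\<^sub>M i\<in>{..<l}. \<mu>"
  interpret P: prob_space ?P by (rule prob_space_PiM) (rule prob_space_axioms)
  define J where "J = ({..<m} \<times> {..<m}) \<rightarrow>\<^sub>E {- int (l ^ 3)..int (l ^ 3)}"
  define f where "f B x = min b (sqrt (max 0
      (\<Sum>i<m. \<Sum>j<m. feature i x * feature j x * (of_int (B (i, j)) / real (l ^ 3)))))"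
    for B :: "nat \<times> nat \<Rightarrow> int" and x
  have f_meas[measurable]: "f B \<in> borel_measurable \<mu>" for B unfolding f_def by measurable
  have f0: "0 \<le> f B x" and fb: "f B x \<le> b" for B x using b by (auto simp: f_def)
  have f_int: "integrable \<mu> (f B)" for B
    using f0 fb by (intro integrable_const_bound[of _ b]) auto
  obtain D where D: "integrable ?P D" "(\<integral>Z. D Z \<partial>?P) \<le> 2 * b * ln (real (card J)) / real l"
      "\<And>Z B. B \<in> J \<Longrightarrow> (\<integral>x. f B x \<partial>\<mu>) \<le> 2 * ((\<Sum>a<l. f B (Z a)) / real l) + D Z"
    by (rule uniform_deviation[OF prob_space_axioms card_grid_le(1,2)[where l = l and m = m, folded J_def],
          where f = f and b = b and l = l])
      (rule f_meas f0 fb b l | blast)+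
  define \<tau> where "\<tau> x = sqrt (tail m x)" for x
  have \<tau>: "integrable \<mu> \<tau>" "(\<integral>x. \<tau> x \<partial>\<mu>) \<le> sqrt (\<Sum>i. \<sigma> (i + m))" "0 \<le> \<tau> x" for x
    unfolding \<tau>_def using integral_sqrt_tail[of m] tail_nonneg[of m x] by auto
  define S where "S Z = sqrt ((\<Sum>a<l. tail s (Z a)) / real l)" for Z :: "nat \<Rightarrow> 'a"
  define T where "T Z = (\<Sum>a<l. \<tau> (Z a)) / real l" for Z :: "nat \<Rightarrow> 'a"
  define R where "R Z = 2 * S Z + 2 * T Z + D Z + (\<integral>x. \<tau> x \<partial>\<mu>) + 3 * (b / real l)" for Z
  have I_le: "(\<integral>x. sqrt (k x x - nystrom k l Z (U Z) (lam Z) s x x) \<partial>\<mu>) \<le> R Z"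
    and I_nonneg: "0 \<le> (\<integral>x. sqrt (k x x - nystrom k l Z (U Z) (lam Z) s x x) \<partial>\<mu>)"
    if Z: "Z \<in> space ?P" for Z
  proof -
    interpret nystrom_features k H ip feature l s Z "U Z" "lam Z" by (rule features[OF Z])
    define A where "A i j = emp.residual (feature i) (feature j)" for i j
    define g where "g x = sqrt (k x x - nystrom k l Z (U Z) (lam Z) s x x)" for x
    define q where "q x = (\<Sum>i<m. \<Sum>j<m. feature i x * feature j x * A i j)" for x
    have A: "\<bar>A i j\<bar> \<le> 1" for i j unfolding A_def by (rule residual_approx)
    have q: "0 \<le> q x" "q x \<le> b\<^sup>2" for x
      using residual_approx(2,3)[of x m] diag_le[of x] unfolding q_def A_def by linarith+
    have g: "g x \<le> sqrt (q x) + \<tau> x" "sqrt (q x) \<le> g x + \<tau> x" for x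
      unfolding g_def q_def A_def \<tau>_def tail_def by (rule residual_approx)+
    \<comment> \<open>The rounded matrix depends on \<open>Z\<close> but lies in the fixed set
      \<open>J\<close>, so the uniform bound with \<open>D\<close> applies to it.\<close>
    define B where "B = (\<lambda>(i, j) \<in> {..<m} \<times> {..<m}. \<lfloor>A i j * real (l ^ 3)\<rfloor>)"
    have "- int (l ^ 3) \<le> \<lfloor>A i j * real (l ^ 3)\<rfloor> \<and> \<lfloor>A i j * real (l ^ 3)\<rfloor> \<le> int (l ^ 3)" for i j
    proof -
      have "\<bar>A i j * real (l ^ 3)\<bar> \<le> 1 * real (l ^ 3)"
        unfolding abs_mult using A[of i j] by (intro mult_mono) auto
      then show ?thesis by (auto simp: le_floor_iff floor_le_iff abs_le_iff)
    qed
    then have B: "B \<in> J" unfolding B_def J_def by (auto simp: PiE_iff extensional_def)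
    have "(\<Sum>i<m. \<Sum>j<m. feature i x * feature j x * (of_int (B (i, j)) / real (l ^ 3)))
        = (\<Sum>i<m. \<Sum>j<m. feature i x * feature j x * (of_int \<lfloor>A i j * real (l ^ 3)\<rfloor> / real (l ^ 3)))"
      for x by (intro sum.cong refl) (simp add: B_def)
    then have fB: "\<bar>sqrt (q x) - f B x\<bar> \<le> b / real l" for x
      using grid_approx[OF l m _ order.trans[OF feature_sum_le diag_le] q[unfolded q_def], of x] b
      unfolding f_def q_def by simp
    have up: "g x \<le> f B x + \<tau> x + b / real l" for x
      using g(1)[of x] fB[of x] by linarith
    have down: "f B x \<le> g x + \<tau> x + b / real l" for x
      using g(2)[of x] fB[of x] by linarith
    have g0: "0 \<le> g x" for x unfolding g_def using residual_bounds(1) by simp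
    have "(\<integral>x. g x \<partial>\<mu>) \<le> (\<integral>x. f B x + \<tau> x + b / real l \<partial>\<mu>)"
      using f_int \<tau>(1) up order.trans[OF g0 up]
      by (intro integral_mono' Bochner_Integration.integrable_add integrable_const) auto
    also have "\<dots> = (\<integral>x. f B x \<partial>\<mu>) + (\<integral>x. \<tau> x \<partial>\<mu>) + b / real l"
      using f_int \<tau>(1) by (simp add: prob_space)
    also have "(\<integral>x. f B x \<partial>\<mu>) \<le> 2 * ((\<Sum>a<l. f B (Z a)) / real l) + D Z" by (rule D(3)[OF B])
    also have "(\<Sum>a<l. f B (Z a)) / real l \<le> (\<Sum>a<l. g (Z a) + \<tau> (Z a) + b / real l) / real l"
      by (intro divide_right_mono sum_mono down) simp
    also have "\<dots> = (\<Sum>a<l. g (Z a)) / real l + (\<Sum>a<l. \<tau> (Z a)) / real l + b / real l"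
      using l by (simp add: sum.distrib add_divide_distrib)
    \<comment> \<open>Jensen's inequality on the sample, followed by Ky Fan's principle.\<close>
    also have "(\<Sum>a<l. g (Z a)) / real l \<le> S Z"
    proof -
      have "(\<Sum>a<l. g (Z a)) / real l
          \<le> sqrt ((\<Sum>a<l. k (Z a) (Z a) - nystrom k l Z (U Z) (lam Z) s (Z a) (Z a)) / real l)"
        unfolding g_def by (intro average_sqrt_le residual_bounds)
      also have "\<dots> \<le> S Z"
        unfolding S_def tail_def
        by (intro real_sqrt_le_mono divide_right_mono sum_residual_sample_le) simp
      finally show ?thesis .
    qed
    finally show "(\<integral>x. sqrt (k x x - nystrom k l Z (U Z) (lam Z) s x x) \<partial>\<mu>) \<le> R Z"
      unfolding R_def T_def g_def by (simp add: algebra_simps)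
    show "0 \<le> (\<integral>x. sqrt (k x x - nystrom k l Z (U Z) (lam Z) s x x) \<partial>\<mu>)"
      using g0 unfolding g_def by (intro integral_nonneg_AE) auto
  qed
  have T: "integrable ?P T" "(\<integral>Z. T Z \<partial>?P) = (\<integral>x. \<tau> x \<partial>\<mu>)"
    unfolding T_def by (rule integral_sample_average[OF prob_space_axioms \<tau>(1) l])+
  have S: "integrable ?P S" "(\<integral>Z. S Z \<partial>?P) \<le> sqrt (\<Sum>i. \<sigma> (i + s))"
  proof -
    note tail_av = integral_sample_average[OF prob_space_axioms tail_integrable[of s] l]
    \<comment> \<open>Jensen's inequality over the draws of \<open>Z\<close>: the sample average of
      \<open>tail s\<close> has the integral of \<open>tail s\<close> as its mean.\<close>
    note sqrt_av = integral_sqrt_le[OF P.prob_space_axioms tail_av(1), unfolded tail_av(2) integral_tail]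
    have "0 \<le> (\<Sum>a<l. tail s (Z a)) / real l" for Z :: "nat \<Rightarrow> 'a"
      by (simp add: sum_nonneg tail_nonneg)
    from sqrt_av[OF this] show "integrable ?P S" "(\<integral>Z. S Z \<partial>?P) \<le> sqrt (\<Sum>i. \<sigma> (i + s))"
      unfolding S_def .
  qed
  have "(\<integral>Z. (\<integral>x. sqrt (k x x - nystrom k l Z (U Z) (lam Z) s x x) \<partial>\<mu>) \<partial>?P) \<le> (\<integral>Z. R Z \<partial>?P)"
    using I_le order.trans[OF I_nonneg I_le] S(1) T(1) D(1) unfolding R_def
    by (intro integral_mono') auto
  also have "\<dots> = 2 * (\<integral>Z. S Z \<partial>?P) + 2 * (\<integral>x. \<tau> x \<partial>\<mu>) + (\<integral>Z. D Z \<partial>?P)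
      + (\<integral>x. \<tau> x \<partial>\<mu>) + 3 * (b / real l)"
    unfolding R_def using S(1) T D(1) by (simp add: P.prob_space)
  also have "\<dots> \<le> 2 * sqrt (\<Sum>i. \<sigma> (i + s)) + 3 * sqrt (\<Sum>i. \<sigma> (i + m))
      + 2 * b * (3 * (real m)\<^sup>2 * ln (1 + 2 * real l)) / real l + 3 * (b / real l)"
  proof -
    have "(\<integral>Z. D Z \<partial>?P) \<le> 2 * b * (3 * (real m)\<^sup>2 * ln (1 + 2 * real l)) / real l"
      using b card_grid_le(3)[of m l, folded J_def]
      by (intro order.trans[OF D(2)] divide_right_mono mult_left_mono) auto
    then show ?thesis using S(2) \<tau>(2) by linarith
  qed
  finally show ?thesis by (simp add: algebra_simps)
qed

end

section \<open>Degenerate cases and final constants\<close>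

theorem corollary1:
  fixes \<mu> :: "'a::t2_space measure"
    and k :: "'a \<Rightarrow> 'a \<Rightarrow> real"
    and H :: "('a \<Rightarrow> real) set"
    and ip :: "('a \<Rightarrow> real) \<Rightarrow> ('a \<Rightarrow> real) \<Rightarrow> real"
    and \<sigma> :: "nat \<Rightarrow> real"
    and e :: "nat \<Rightarrow> 'a \<Rightarrow> real"
    and l s m :: nat
    and U :: "(nat \<Rightarrow> 'a) \<Rightarrow> real mat"
    and lam :: "(nat \<Rightarrow> 'a) \<Rightarrow> nat \<Rightarrow> real"
  assumes "prob_space \<mu>" and "sets \<mu> = sets borel"
    and "pos_def_kernel k" and "bdd_above (range (\<lambda>x. k x x))"
    and "rkhs k H ip"
    and "eigenpairs \<mu> k \<sigma> e"
    and mercer: "\<And>x y. (\<lambda>i. \<sigma> i * e i x * e i y) sums k x y"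
    and "orthonormal_basis H ip {i. \<sigma> i > 0} (\<lambda>i x. sqrt (\<sigma> i) * e i x)"
    and "1 \<le> s" and "s \<le> l" and "1 \<le> m"
    and decomp: "\<And>Z. Z \<in> space (\<Pi>\<^sub>M i\<in>{..<l}. \<mu>) \<Longrightarrow>
           spectral_decomp l (gram_mat k l Z) (U Z) (lam Z)"
    \<comment> \<open>the expectation is meaningful: with repeated eigenvalues, the choice of the
        decomposition, and hence the integrand, need not depend measurably on \<open>Z\<close>\<close>
    and measurable: "(\<lambda>Z. \<integral>x. sqrt (k x x - nystrom k l Z (U Z) (lam Z) s x x) \<partial>\<mu>)
           \<in> borel_measurable (\<Pi>\<^sub>M i\<in>{..<l}. \<mu>)"
  shows "(\<integral>Z. (\<integral>x. sqrt (k x x - nystrom k l Z (U Z) (lam Z) s x x) \<partial>\<mu>) \<partial>(\<Pi>\<^sub>M i\<in>{..<l}. \<mu>))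
    \<le> 2 * sqrt (\<Sum>i. \<sigma> (i + s)) + 4 * sqrt (\<Sum>i. \<sigma> (i + m))
       + sqrt (SUP x. k x x) / real l * (80 * (real m)\<^sup>2 * ln (1 + 2 * real l) / 9 + 69)"
proof -
  interpret prob_space \<mu> by fact
  interpret rkhs k H ip by fact
  interpret semi_inner H ip by (rule rkhs_semi_inner) fact
  let ?P = "\<Pi>\<^sub>M i\<in>{..<l}. \<mu>"
  interpret P: prob_space ?P by (rule prob_space_PiM) (rule prob_space_axioms)
  define b where "b = sqrt (SUP x. k x x)"
  have diag_nonneg: "0 \<le> k x x" for x
    using ip_nonneg[OF kernel_mem] by (simp add: reproducing[OF kernel_mem])
  have diag_le_SUP: "k x x \<le> (SUP x. k x x)" for x
    using assms(4) by (intro cSUP_upper) auto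
  have SUP_nonneg: "0 \<le> (SUP x. k x x)"
    using diag_nonneg diag_le_SUP order.trans by blast
  have b: "0 \<le> b" "\<And>x. k x x \<le> b\<^sup>2"
    using SUP_nonneg diag_le_SUP by (simp_all add: b_def)
  interpret mercer_kernel \<mu> k b \<sigma> e
    by standard (use assms(6) mercer b in auto)
  have l: "0 < l" using assms(9,10) by simp
  have basis: "feature i \<in> H" "ip (feature i) (feature j) = (if i = j then 1 else 0)"
    if "0 < \<sigma> i" "0 < \<sigma> j" for i j
    using assms(8) that by (auto simp: orthonormal_basis_def feature_def[abs_def])
  \<comment> \<open>The given basis is indexed by the positive eigenvalues only; zero features
    extend it to all indices.\<close>
  have null: "feature i = (\<lambda>x. 0)" if "\<not> 0 < \<sigma> i" for i
    using that sigma_nonneg[of i] by (simp add: feature_def fun_eq_iff)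
  have mem: "feature i \<in> H" for i
    using basis(1) null zero_mem by (cases "0 < \<sigma> i") auto
  have ip_zero: "ip (\<lambda>x. 0) f = 0" "ip f (\<lambda>x. 0) = 0" if "f \<in> H" for f
    using ip_scale[OF zero_mem that, of 0] ip_commute[OF that zero_mem] by auto
  have features: "nystrom_features k H ip feature l s Z (U Z) (lam Z)" if "Z \<in> space ?P" for Z
  proof
    show "feature i \<in> H" for i by (rule mem)
    show "ip (feature i) (feature j) = 0" if "i \<noteq> j" for i j
      using basis(2)[of i j] null ip_zero[OF mem] ip_zero[OF zero_mem] that
      by (cases "0 < \<sigma> i"; cases "0 < \<sigma> j") auto
    show "ip (feature i) (feature i) \<le> 1" for i
      using basis(2)[of i i] null ip_zero[OF zero_mem] by (cases "0 < \<sigma> i") auto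
  qed (use decomp[OF that] assms(9,10) in auto)
  define E where "E = (\<integral>Z. (\<integral>x. sqrt (k x x - nystrom k l Z (U Z) (lam Z) s x x) \<partial>\<mu>) \<partial>?P)"
  define c where "c = 80 * (real m)\<^sup>2 * ln (1 + 2 * real l) / 9 + 69"
  have tail_sum_nonneg: "0 \<le> (\<Sum>i. \<sigma> (i + n))" for n
    unfolding integral_tail[symmetric] by (rule integral_nonneg_AE) (simp add: tail_nonneg)
  \<comment> \<open>This is \<open>exp 1 \<le> 3 \<le> 1 + 2 * l\<close>.\<close>
  have ln_ge: "1 \<le> ln (1 + 2 * real l)"
    using ln_ge_iff[of "1 + 2 * real l" 1] exp_le l by simp
  have prod_nonneg: "0 \<le> (real m)\<^sup>2 * ln (1 + 2 * real l)"
    using ln_ge by simp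
  have "E \<le> 2 * sqrt (\<Sum>i. \<sigma> (i + s)) + 4 * sqrt (\<Sum>i. \<sigma> (i + m)) + b / real l * c"
  \<comment> \<open>The rounding needs \<open>m \<le> l\<close> and the deviation bound needs
    \<open>b > 0\<close>. Otherwise the trivial bound \<open>E \<le> b\<close> suffices.\<close>
  proof (cases "b = 0 \<or> l < m")
    case True
    have "E \<le> (\<integral>Z. b \<partial>?P)"
      unfolding E_def
    proof (rule integral_mono')
      fix Z assume Z: "Z \<in> space ?P"
      interpret nystrom_features k H ip feature l s Z "U Z" "lam Z" by (rule features[OF Z])
      have "(\<integral>x. sqrt (k x x - nystrom k l Z (U Z) (lam Z) s x x) \<partial>\<mu>) \<le> (\<integral>x. b \<partial>\<mu>)"
        using b order.trans[OF residual_bounds(2) b(2)]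
        by (intro integral_mono' integrable_const real_le_lsqrt) auto
      then show "(\<integral>x. sqrt (k x x - nystrom k l Z (U Z) (lam Z) s x x) \<partial>\<mu>) \<le> b"
        by (simp add: prob_space)
    qed (use b in auto)
    then have E: "E \<le> b" by (simp add: P.prob_space)
    have "b \<le> b / real l * c"
    proof (cases "b = 0")
      case False
      \<comment> \<open>Now \<open>l < m\<close>, and the chain yields \<open>l \<le> c\<close>,
        that is, \<open>b \<le> b / l * c\<close>.\<close>
      with True have "real l \<le> real m" by simp
      also have "\<dots> \<le> (real m)\<^sup>2" using assms(11) by (simp add: power2_eq_square)
      also have "\<dots> \<le> (real m)\<^sup>2 * ln (1 + 2 * real l)"
        using mult_left_mono[OF ln_ge, of "(real m)\<^sup>2"] by simp
      also have "\<dots> \<le> c"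
        unfolding c_def using prod_nonneg by linarith
      finally show ?thesis using b l by (simp add: field_simps mult_left_mono)
    qed simp
    moreover have "0 \<le> sqrt (\<Sum>i. \<sigma> (i + s))" "0 \<le> sqrt (\<Sum>i. \<sigma> (i + m))"
      using tail_sum_nonneg by simp_all
    ultimately show ?thesis using E by linarith
  next
    case False
    have "E \<le> 2 * sqrt (\<Sum>i. \<sigma> (i + s)) + 3 * sqrt (\<Sum>i. \<sigma> (i + m))
        + b / real l * (6 * (real m)\<^sup>2 * ln (1 + 2 * real l) + 3)"
      unfolding E_def by (rule expected_residual_le[OF features]) (use False b l in auto)
    also have "\<dots> \<le> 2 * sqrt (\<Sum>i. \<sigma> (i + s)) + 4 * sqrt (\<Sum>i. \<sigma> (i + m)) + b / real l * c"
    proof -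
      \<comment> \<open>The constants leave room: \<open>6 \<le> 80 / 9\<close> and
        \<open>3 \<le> 69\<close>.\<close>
      have "6 * (real m)\<^sup>2 * ln (1 + 2 * real l) + 3 \<le> c"
        unfolding c_def using prod_nonneg by linarith
      then have "b / real l * (6 * (real m)\<^sup>2 * ln (1 + 2 * real l) + 3) \<le> b / real l * c"
        using b by (intro mult_left_mono) auto
      moreover have "0 \<le> sqrt (\<Sum>i. \<sigma> (i + m))" using tail_sum_nonneg by simp
      ultimately show ?thesis by linarith
    qed
    finally show ?thesis .
  qed
  then show ?thesis unfolding E_def b_def c_def .
qed

end
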